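(* Let $\lambda\ge0$. The $\lambda^+$-biased edge-reinforced random walk $(X_n)_{n\ge 0}$ on $\mathbb{Z}$ has positive speed if and only if $\lambda>3$. If $\lambda>3$, then $\frac{X_n}{n}\to\frac{\lambda-3}{\lambda+1}$ almost surely as $n\to\infty$. Otherwise, $\frac{X_n}{n}\to 0$ almost surely.
   Context: The $\lambda^+$-biased edge-reinforced random walk on $\mathbb{Z}$ (edge-reinforced random walk with initial additive bias $\lambda\ge0$) is the nearest-neighbour process $(X_n)_{n\ge0}$ with $X_0=0$ and $$\mathbb{P}[X_{n+1}=x_n+1\mid X_n=x_n,\dots,X_0=x_0]=\frac{\lambda+w(n,x_n)}{\lambda+w(n,x_n)+w(n,x_n-1)},$$ and $X_{n+1}=x_n-1$ otherwise, where $w(n,z)$ is the weight of the edge $\{z,z+1\}$ at time $n$: $$w(n,z)=w(0,z)+\sum_{i=0}^{n-1}\left(\mathbf{1}_{X_i=z,\,X_{i+1}=z+1}+\mathbf{1}_{X_i=z+1,\,X_{i+1}=z}\right),\qquad w(0,z)=1\text{ for all }z\in\mathbb{Z}.$$ The speed is the almost sure limit of $X_n/n$. *)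

theory Defs
  imports "HOL-Probability.Probability"
begin

text \<open>Weight at time \<open>n\<close> of the edge between \<open>z\<close> and \<open>z + 1\<close>, for a walk following the path
  \<open>x\<close>. It depends on \<open>x\<close> only through \<open>x 0, \<dots>, x n\<close>. All initial weights are 1.\<close>

definition edge_weight :: "(nat \<Rightarrow> int) \<Rightarrow> nat \<Rightarrow> int \<Rightarrow> real" where
  "edge_weight x n z = 1 + (\<Sum>i<n. of_bool (x i = z \<and> x (Suc i) = z + 1)
                               + of_bool (x i = z + 1 \<and> x (Suc i) = z))"

text \<open>The process is characterised by its law, on an arbitrary probability space. The transition
  rule is required only for histories of positive probability, as conditional probabilities given
  null events carry no information.\<close>

locale biased_errw = prob_space M
  for M :: "'a measure" and X :: "nat \<Rightarrow> 'a \<Rightarrow> int" and lam :: real +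
  assumes random_variable_X: "random_variable (count_space UNIV) (X n)"
    and start: "AE \<omega> in M. X 0 \<omega> = 0"
    and nearest_neighbour:
      "AE \<omega> in M. \<forall>n. X (Suc n) \<omega> = X n \<omega> + 1 \<or> X (Suc n) \<omega> = X n \<omega> - 1"
    and step_right:
      "\<P>(\<omega> in M. \<forall>i\<le>n. X i \<omega> = x i) > 0 \<Longrightarrow>
       \<P>(\<omega> in M. X (Suc n) \<omega> = x n + 1 \<bar> \<forall>i\<le>n. X i \<omega> = x i) =
         (lam + edge_weight x n (x n)) /
         (lam + edge_weight x n (x n) + edge_weight x n (x n - 1))"

definition has_speed :: "'a measure \<Rightarrow> (nat \<Rightarrow> 'a \<Rightarrow> int) \<Rightarrow> real \<Rightarrow> bool" where
  "has_speed M X v \<longleftrightarrow> (AE \<omega> in M. (\<lambda>n. real_of_int (X n \<omega>) / real n) \<longlonglongrightarrow> v)"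

end

theory Submission
  imports Defs
begin

text \<open>
  With all edge weights halved, the walk uses at each site an independent Polya urn, with initial
  weights \<open>(\<lambda> + 1) / 2\<close> (right) and \<open>1\<close> (left) at the positive sites. The hitting time of \<open>N\<close> is \<open>N\<close>
  plus twice the number of left steps made before it, and as in the Ray--Knight theorems the
  numbers of left steps from \<open>N - 1, N - 2, \<dots>\<close> form a Markov chain.

  For right weight \<open>a > 2\<close> the part of this chain on the positive sites is reversible with respect to
  the explicit weights \<open>k! / (a + 1)\<^sub>k\<close>, so that it has moments of some order \<open>q > 1\<close> bounded uniformly
  in \<open>N\<close>. A martingale estimate of von Bahr--Esseen type shows that the hitting time of \<open>N\<close> deviates
  from \<open>N * a / (a - 2)\<close> by a multiple of \<open>N\<close> with probability \<open>O(N powr (1 - q))\<close>, which is summable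
  along the \<open>m\<close>-th powers for large \<open>m\<close>. The time spent on the other sites has bounded mean.

  For \<open>\<lambda> \<le> 3\<close>, and for the reflected walk, the chain stochastically dominates the chains with \<open>a > 2\<close>
  arbitrarily close to 2, hence the speed vanishes in both directions.
\<close>

section \<open>Polya urns\<close>

text \<open>The walk is given only by its conditional step probabilities on an arbitrary space, so
  there are no random urns to work with. Instead the chain is defined for every finite history, from
  the step counts made so far, as the conditional law of the number of left steps; backward
  induction on time then identifies the hitting probabilities without a coupling. Halving turns
  edges into urns because an edge is crossed alternately in both directions: between two departures
  across it from the same site its weight grows by 2. The weights
  \<open>k! / (a + 1)\<^sub>k\<close> decay like \<open>k powr - a\<close>. Their first moment is
  finite only for \<open>a > 2\<close>, that is \<open>\<lambda> > 3\<close>, and for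
  \<open>a \<le> 3\<close> they have no second moment. The resulting bound need not be summable over
  all \<open>N\<close>, but it is along \<open>N = i ^ m\<close> for large \<open>m\<close>;
  successive \<open>m\<close>-th powers have ratio tending to 1, so the passage to all times loses
  nothing in the limit.\<close>

definition geo_pmf :: "real \<Rightarrow> real \<Rightarrow> nat pmf" where
  "geo_pmf A B = embed_pmf (\<lambda>j. A * pochhammer B j / pochhammer (A + B) (Suc j))"

text \<open>The quotient is the probability that the first \<open>n\<close> draws of the urn are all
  left. By Euler's limit for \<open>Gamma\<close> it is of order \<open>n powr - A\<close>, so a
  right draw comes eventually.\<close>

lemma pochhammer_ratio_tendsto_0:
  fixes A B :: real
  assumes "A > 0" "B > 0"
  shows "(\<lambda>n. pochhammer B n / pochhammer (A + B) n) \<longlonglongrightarrow> 0"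
proof -
  have 1: "(\<lambda>n. Gamma_series (A + B) n / Gamma_series B n) \<longlonglongrightarrow> Gamma (A + B) / Gamma B"
    using assms by (intro tendsto_divide Gamma_series_LIMSEQ)
      (auto simp: Gamma_eq_zero_iff dest: nonpos_Ints_nonpos)
  have 2: "(\<lambda>n::nat. real n powr - A) \<longlonglongrightarrow> 0"
    using assms by real_asymp
  have 3: "(\<lambda>n. Gamma_series (A + B) n / Gamma_series B n * real n powr - A) \<longlonglongrightarrow> 0"
    using tendsto_mult[OF 1 2] by simp
  have "\<forall>\<^sub>F n in sequentially. Gamma_series (A + B) n / Gamma_series B n * real n powr - A
        = pochhammer B (Suc n) / pochhammer (A + B) (Suc n)"
    using eventually_gt_at_top[of 0]
  proof eventually_elim
    case (elim n)
    have "pochhammer B (Suc n) > 0" "pochhammer (A + B) (Suc n) > 0"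
      using assms by (auto intro!: pochhammer_pos)
    then show ?case using elim assms
      by (simp add: Gamma_series_def field_simps exp_add exp_diff powr_def exp_minus
          del: pochhammer_Suc)
  qed
  then have "(\<lambda>n. pochhammer B (Suc n) / pochhammer (A + B) (Suc n)) \<longlonglongrightarrow> 0"
    using 3 by (rule Lim_transform_eventually[rotated])
  then show ?thesis by (rule LIMSEQ_imp_Suc)
qed

text \<open>The masses telescope: each is the probability of \<open>j\<close> initial left draws
  minus that of \<open>j + 1\<close>. Hence they sum to 1, which is what \<open>embed_pmf\<close>
  requires.\<close>

lemma pmf_geo:
  assumes "A > 0" "B > 0"
  shows "pmf (geo_pmf A B) j = A * pochhammer B j / pochhammer (A + B) (Suc j)"
proof -
  let ?f = "\<lambda>j. A * pochhammer B j / pochhammer (A + B) (Suc j)"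
  let ?g = "\<lambda>n. pochhammer B n / pochhammer (A + B) n"
  have pos: "pochhammer B j > 0" "pochhammer (A + B) j > 0" for j
    using assms by (auto intro!: pochhammer_pos)
  have nn: "?f j \<ge> 0" for j
    using pos[of j] pos[of "Suc j"] assms by (intro divide_nonneg_nonneg mult_nonneg_nonneg) auto
  have f: "?f j = ?g j - ?g (Suc j)" for j
  proof -
    have "A + B + real j \<noteq> 0" using assms by simp
    then show ?thesis using pos[of j] by (simp add: pochhammer_Suc divide_simps) (simp add: algebra_simps)
  qed
  have "?f sums (?g 0 - 0)"
    unfolding f using pochhammer_ratio_tendsto_0[OF assms] by (rule telescope_sums')
  then have "(\<Sum>j. ennreal (?f j)) = 1"
    using nn by (subst suminf_ennreal2) (auto simp: sums_iff)
  then show ?thesis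
    unfolding geo_pmf_def using nn
    by (intro pmf_embed_pmf) (auto simp: nn_integral_count_space_nat)
qed

lemma geo_step:
  assumes "A > 0" "B > 0"
  shows "geo_pmf A B = bind_pmf (bernoulli_pmf (A / (A + B)))
    (\<lambda>b. if b then return_pmf 0 else map_pmf Suc (geo_pmf A (B + 1)))" (is "_ = ?R")
proof (rule pmf_eqI)
  fix j
  have p: "0 \<le> A / (A + B)" "A / (A + B) \<le> 1" using assms by auto
  have R: "pmf ?R j = A / (A + B) * indicator {0} j +
      (1 - A / (A + B)) * pmf (map_pmf Suc (geo_pmf A (B + 1))) j"
    using p by (simp add: pmf_bind indicator_def of_bool_def)
  show "pmf (geo_pmf A B) j = pmf ?R j"
  proof (cases j)
    case 0
    have "pmf (map_pmf Suc (geo_pmf A (B + 1))) 0 = 0"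
      by (auto simp: pmf_eq_0_set_pmf)
    then show ?thesis using assms 0 unfolding R by (simp add: pmf_geo)
  next
    case (Suc i)
    have "pochhammer (A + B) (Suc (Suc i)) = (A + B) * pochhammer (A + B + 1) (Suc i)"
      "pochhammer B (Suc i) = B * pochhammer (B + 1) i"
      by (rule pochhammer_rec)+
    moreover have "1 - A / (A + B) = B / (A + B)" using assms by (simp add: field_simps)
    moreover have "pmf (map_pmf Suc (geo_pmf A (B + 1))) (Suc i) = pmf (geo_pmf A (B + 1)) i"
      by (rule pmf_map_inj') auto
    ultimately show ?thesis using assms Suc unfolding R
      by (simp add: pmf_geo add.assoc del: pochhammer_Suc)
  qed
qed

text \<open>The number of left steps preceding the \<open>d\<close>-th right step of a Polya urn with initial
  weights \<open>A\<close> (right) and \<open>B\<close> (left) and unit reinforcement; \<open>geo_pmf\<close> is the case \<open>d = 1\<close>.\<close>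

primrec urn_pmf :: "real \<Rightarrow> real \<Rightarrow> nat \<Rightarrow> nat pmf" where
  "urn_pmf A B 0 = return_pmf 0"
| "urn_pmf A B (Suc d) =
     bind_pmf (geo_pmf A B) (\<lambda>j. map_pmf (\<lambda>k. j + k) (urn_pmf (A + 1) (B + real j) d))"

text \<open>Conditioning on the first draw. In \<open>chain_step\<close> this draw becomes one step
  of the walk.\<close>

lemma urn_step:
  assumes "A > 0" "B > 0"
  shows "urn_pmf A B (Suc d) = bind_pmf (bernoulli_pmf (A / (A + B)))
    (\<lambda>b. if b then urn_pmf (A + 1) B d else map_pmf Suc (urn_pmf A (B + 1) (Suc d)))"
proof -
  have "urn_pmf A B (Suc d) = bind_pmf (bernoulli_pmf (A / (A + B)))
    (\<lambda>b. bind_pmf (if b then return_pmf 0 else map_pmf Suc (geo_pmf A (B + 1)))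
       (\<lambda>j. map_pmf (\<lambda>k. j + k) (urn_pmf (A + 1) (B + real j) d)))"
    by (simp only: urn_pmf.simps geo_step[OF assms] bind_assoc_pmf)
  moreover have "map_pmf ((+) 0) p = p" for p :: "nat pmf"
    by (simp add: pmf.map_ident_strong)
  ultimately show ?thesis
    by (simp only:) (intro bind_pmf_cong refl,
      auto simp: bind_map_pmf map_bind_pmf bind_return_pmf pmf.map_comp o_def add_ac
        pmf.map_ident intro!: bind_pmf_cong map_pmf_cong)
qed

lemma pmf_urn_step:
  assumes "A > 0" "B > 0"
  shows "pmf (urn_pmf A B (Suc d)) j = A / (A + B) * pmf (urn_pmf (A + 1) B d) j +
    B / (A + B) * (case j of 0 \<Rightarrow> 0 | Suc i \<Rightarrow> pmf (urn_pmf A (B + 1) (Suc d)) i)"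
proof -
  have p: "0 \<le> A / (A + B)" "A / (A + B) \<le> 1" using assms by auto
  have q: "1 - A / (A + B) = B / (A + B)" using assms by (simp add: field_simps)
  have m: "pmf (map_pmf Suc (urn_pmf A (B + 1) (Suc d))) j =
     (case j of 0 \<Rightarrow> 0 | Suc i \<Rightarrow> pmf (urn_pmf A (B + 1) (Suc d)) i)"
    by (cases j) (auto simp: pmf_eq_0_set_pmf pmf_map_inj' simp del: urn_pmf.simps)
  show ?thesis
    unfolding urn_step[OF assms] using p
    by (simp add: pmf_bind q m mult_ac del: urn_pmf.simps)
qed

text \<open>Exchangeability: the binomial coefficient counts the orders of the draws in which the
  last one is right, and all of them are equally likely. The induction on the number of draws is
  Pascal's rule.\<close>

lemma pmf_urn:
  assumes "A > 0" "B > 0"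
  shows "pmf (urn_pmf A B (Suc d)) j =
    real (d + j choose j) * pochhammer A (Suc d) * pochhammer B j / pochhammer (A + B) (Suc d + j)"
  using assms
proof (induction "d + j" arbitrary: A B d j rule: less_induct)
  case (less d j A B)
  note IH = less.hyps
  have AB: "A + B > 0" and prems: "A > 0" "B > 0" using less.prems by simp_all
  have p0: "pochhammer (A + B + 1) n > 0" for n using AB by (intro pochhammer_pos) auto
  have r: "pochhammer (A + B) (Suc n) = (A + B) * pochhammer (A + B + 1) n"
    "pochhammer A (Suc n) = A * pochhammer (A + 1) n"
    "pochhammer B (Suc n) = B * pochhammer (B + 1) n" for n
    by (rule pochhammer_rec)+
  have 1: "pmf (urn_pmf (A + 1) B d) j = (if d = 0 then of_bool (j = 0) else
     real (d - 1 + j choose j) * pochhammer (A + 1) d * pochhammer B j / pochhammer (A + B + 1) (d + j))"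
  proof (cases d)
    case (Suc d')
    show ?thesis using IH[of d' j "A + 1" B] less.prems
      by (simp add: Suc add_ac del: urn_pmf.simps)
  qed (auto simp: indicator_def)
  have 2: "pmf (urn_pmf A (B + 1) (Suc d)) i =
     real (d + i choose i) * pochhammer A (Suc d) * pochhammer (B + 1) i / pochhammer (A + B + 1) (Suc d + i)"
    if "j = Suc i" for i
    using IH[of d i A "B + 1"] less.prems that by (simp add: add_ac del: urn_pmf.simps)
  show ?case
  proof (cases j)
    case 0
    then show ?thesis using AB p0[of d]
      unfolding pmf_urn_step[OF prems] 1 by (cases d) (simp_all add: r del: pochhammer_Suc)
  next
    case (Suc i)
    have Q: "pochhammer (A + B + 1) (Suc (d + i)) \<noteq> 0" using p0[of "Suc (d + i)"] by linarith
    have "A / (A + B) * pmf (urn_pmf (A + 1) B d) j =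
       (if d = 0 then 0 else real (d + i choose j)) * pochhammer A (Suc d) * pochhammer B j / pochhammer (A + B) (Suc d + j)"
      unfolding 1 using Suc by (cases d) (simp_all add: r)
    moreover have "B / (A + B) * pmf (urn_pmf A (B + 1) (Suc d)) i =
       real (d + i choose i) * pochhammer A (Suc d) * pochhammer B j / pochhammer (A + B) (Suc d + j)"
      unfolding 2[OF Suc] using Suc by (simp add: r(1,3) del: pochhammer_Suc)
    moreover have "real (d + j choose j) = (if d = 0 then 0 else real (d + i choose j)) + real (d + i choose i)"
      using Suc by (cases d) simp_all
    ultimately show ?thesis
      unfolding pmf_urn_step[OF prems] using Suc
      by (simp add: add_divide_distrib distrib_right del: pochhammer_Suc urn_pmf.simps binomial_Suc_Suc)
  qed
qed

text \<open>The factor \<open>B + j\<close> extends \<open>pochhammer B j\<close> by one term, so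
  biasing by it gives a multiple of the law with parameters \<open>A - 1\<close> and
  \<open>B + 1\<close>.\<close>

lemma nn_integral_geo:
  assumes "A > 1" "B > 0"
  shows "(\<integral>\<^sup>+j. ennreal (B + real j) \<partial>geo_pmf A B) = ennreal (A * B / (A - 1))"
proof -
  have "(\<integral>\<^sup>+j. ennreal (B + real j) \<partial>geo_pmf A B)
      = (\<integral>\<^sup>+j. ennreal (pmf (geo_pmf A B) j) * ennreal (B + real j) \<partial>count_space UNIV)"
    by (simp add: nn_integral_measure_pmf)
  also have "\<dots> = (\<integral>\<^sup>+j. ennreal (A * B / (A - 1)) * ennreal (pmf (geo_pmf (A - 1) (B + 1)) j) \<partial>count_space UNIV)"
  proof (rule nn_integral_cong)
    fix j :: nat
    have "pochhammer B j * (B + real j) = B * pochhammer (B + 1) j"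
      using pochhammer_rec[of B j] pochhammer_Suc[of B j] by simp
    then have "pmf (geo_pmf A B) j * (B + real j) = A * B / (A - 1) * pmf (geo_pmf (A - 1) (B + 1)) j"
      using assms by (simp add: pmf_geo add_ac del: pochhammer_Suc)
    then show "ennreal (pmf (geo_pmf A B) j) * ennreal (B + real j) =
        ennreal (A * B / (A - 1)) * ennreal (pmf (geo_pmf (A - 1) (B + 1)) j)"
      using assms by (simp flip: ennreal_mult ennreal_plus)
  qed
  also have "\<dots> = ennreal (A * B / (A - 1))"
    by (simp add: nn_integral_cmult nn_integral_pmf)
  finally show ?thesis .
qed

text \<open>The left weight \<open>B + k\<close> is tracked instead of \<open>k\<close> because each
  run of left draws multiplies its mean by a constant; the constants \<open>A / (A - 1)\<close>,
  \<open>(A + 1) / A\<close>, ... telescope.\<close>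

lemma nn_integral_urn:
  assumes "A > 1" "B > 0"
  shows "(\<integral>\<^sup>+k. ennreal (B + real k) \<partial>urn_pmf A B d) = ennreal (B * (A + real d - 1) / (A - 1))"
  using assms
proof (induction d arbitrary: A B)
  case (Suc d)
  have "(\<integral>\<^sup>+k. ennreal (B + real k) \<partial>urn_pmf A B (Suc d)) =
     (\<integral>\<^sup>+j. \<integral>\<^sup>+k. ennreal (B + real j + real k) \<partial>urn_pmf (A + 1) (B + real j) d \<partial>geo_pmf A B)"
    by (simp add: add_ac)
  also have "\<dots> = (\<integral>\<^sup>+j. ennreal ((A + real d) / A) * ennreal (B + real j) \<partial>geo_pmf A B)"
  proof (rule nn_integral_cong)
    fix j :: nat
    have "(\<integral>\<^sup>+k. ennreal (B + real j + real k) \<partial>urn_pmf (A + 1) (B + real j) d) =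
        ennreal ((B + real j) * (A + 1 + real d - 1) / (A + 1 - 1))"
      using Suc.prems by (intro Suc.IH) auto
    then show "(\<integral>\<^sup>+k. ennreal (B + real j + real k) \<partial>urn_pmf (A + 1) (B + real j) d) =
        ennreal ((A + real d) / A) * ennreal (B + real j)"
      using Suc.prems by (simp flip: ennreal_mult ennreal_plus add: mult.commute)
  qed
  also have "\<dots> = ennreal ((A + real d) / A) * ennreal (A * B / (A - 1))"
    using Suc.prems by (subst nn_integral_cmult) (simp_all add: nn_integral_geo del: ennreal_plus)
  also have "\<dots> = ennreal (B * (A + real (Suc d) - 1) / (A - 1))"
    using Suc.prems by (simp add: ennreal_mult[symmetric] field_simps)
  finally show ?case .
qed auto

lemma nn_integral_urn_id:
  assumes "A > 1" "B > 0"
  shows "(\<integral>\<^sup>+k. ennreal (real k) \<partial>urn_pmf A B d) = ennreal (B * real d / (A - 1))"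
proof -
  have "(\<integral>\<^sup>+k. ennreal (real k) \<partial>urn_pmf A B d) + ennreal B = (\<integral>\<^sup>+k. ennreal (B + real k) \<partial>urn_pmf A B d)"
    using assms by (simp add: nn_integral_add)
  also have "\<dots> = ennreal (B * real d / (A - 1)) + ennreal B"
    using assms by (simp add: nn_integral_urn flip: ennreal_plus) (simp add: field_simps)
  finally show ?thesis by simp
qed

section \<open>Stochastic comparison of urn laws\<close>

lemma sums_expectation:
  fixes F :: "nat \<Rightarrow> real"
  assumes "\<And>k. 0 \<le> F k" "\<And>k. F k \<le> 1"
  shows "(\<lambda>k. pmf s k * F k) sums measure_pmf.expectation s F"
proof -
  have int: "integrable (measure_pmf s) F"
    using assms by (intro measure_pmf.integrable_const_bound[of _ 1]) auto
  have "integrable (count_space UNIV) (\<lambda>k. pmf s k * F k)"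
    using int unfolding measure_pmf_eq_density by (subst (asm) integrable_density) auto
  then have "(\<lambda>k. pmf s k * F k) sums (\<integral>k. pmf s k * F k \<partial>count_space UNIV)"
    by (rule sums_integral_count_space_nat)
  also have "(\<integral>k. pmf s k * F k \<partial>count_space UNIV) = measure_pmf.expectation s F"
    unfolding measure_pmf_eq_density by (subst integral_density) auto
  finally show ?thesis .
qed

text \<open>A monotone likelihood ratio implies stochastic domination: with \<open>k\<^sub>0\<close> the first point where the
  ratio reaches 1, both factors of \<open>(q k - p k) * (F k - F k\<^sub>0)\<close> change sign at \<open>k\<^sub>0\<close>.\<close>

lemma monotone_likelihood_ratio:
  fixes p q :: "nat pmf" and F :: "nat \<Rightarrow> real"
  assumes pos: "\<And>k. pmf p k > 0"
    and mlr: "\<And>k. pmf q k * pmf p (Suc k) \<le> pmf q (Suc k) * pmf p k"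
    and F: "antimono F" "\<And>k. 0 \<le> F k" "\<And>k. F k \<le> 1"
  shows "measure_pmf.expectation q F \<le> measure_pmf.expectation p F"
proof -
  define r where "r k = pmf q k / pmf p k" for k
  have "r k \<le> r (Suc k)" for k
    using mlr[of k] pos[of k] pos[of "Suc k"] by (simp add: r_def field_simps)
  then have mono: "r i \<le> r j" if "i \<le> j" for i j using that by (rule lift_Suc_mono_le)
  have sum1: "(\<lambda>k. pmf s k) sums 1" for s :: "nat pmf"
    using sums_expectation[of "\<lambda>_. 1" s] by simp
  have sumF: "(\<lambda>k. pmf s k * F k) sums measure_pmf.expectation s F" for s :: "nat pmf"
    using F by (intro sums_expectation) auto
  have "\<exists>k. r k \<ge> 1"
  proof (rule ccontr)
    assume "\<not> (\<exists>k. r k \<ge> 1)"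
    then have lt1: "r k < 1" for k by (simp add: not_le)
    have lt: "pmf q k < pmf p k" for k
      using pos[of k] lt1[of k] unfolding r_def by (simp only: divide_less_eq_1_pos)
    have "(\<lambda>k. pmf p k - pmf q k) sums 0" using sums_diff[OF sum1[of p] sum1[of q]] by simp
    then have "pmf p 0 - pmf q 0 \<le> 0"
      using sum_le_suminf[of "\<lambda>k. pmf p k - pmf q k" "{0}"] lt by (auto simp: sums_iff less_imp_le)
    then show False using lt[of 0] by simp
  qed
  then obtain k0 where k0: "r k0 \<ge> 1" "\<And>k. k < k0 \<Longrightarrow> r k < 1"
    using exists_least_iff[of "\<lambda>k. r k \<ge> 1"] by (auto simp: not_le)
  have le: "pmf q k * F k - pmf p k * F k - (pmf q k - pmf p k) * F k0 \<le> 0" for k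
  proof (cases "k < k0")
    case True
    then have "pmf q k \<le> pmf p k" "F k0 \<le> F k" using k0(2)[OF True] pos[of k] F(1)
      by (auto simp: r_def antimono_def)
    then have "(pmf q k - pmf p k) * (F k - F k0) \<le> 0" by (intro mult_nonpos_nonneg) auto
    then show ?thesis by (simp add: algebra_simps)
  next
    case False
    then have "r k \<ge> 1" "F k0 \<ge> F k" using k0(1) mono[of k0 k] F(1)
      by (auto simp: antimono_def)
    then have "pmf q k \<ge> pmf p k" "F k0 \<ge> F k" using pos[of k]
      by (auto simp: r_def)
    then have "(pmf q k - pmf p k) * (F k - F k0) \<le> 0" by (intro mult_nonneg_nonpos) auto
    then show ?thesis by (simp add: algebra_simps)
  qed
  have "(\<lambda>k. pmf q k * F k - pmf p k * F k - (pmf q k - pmf p k) * F k0) sums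
     (measure_pmf.expectation q F - measure_pmf.expectation p F - (1 - 1) * F k0)"
    by (intro sums_diff sums_mult2 sumF sum1)
  then show ?thesis using sums_le[OF le _ sums_zero] by fastforce
qed

lemma frac_mono:
  fixes c x y :: real
  assumes "0 < c" "0 \<le> x" "x \<le> y"
  shows "x / (c + x) \<le> y / (c + y)"
proof -
  have "x * (c + y) \<le> y * (c + x)"
    using mult_left_mono[of x y c] assms by (simp add: distrib_left mult.commute)
  moreover have "c + x > 0" "c + y > 0" using assms by auto
  ultimately show ?thesis by (simp add: pos_divide_le_eq pos_le_divide_eq mult.commute)
qed

text \<open>Consecutive masses have the quotient
  \<open>(d + 1 + k) / (k + 1) * (B + k) / (A + B + d + 1 + k)\<close>, which decreases in
  \<open>A\<close> and increases in \<open>B\<close> and \<open>d\<close>. With \<open>Suc d\<close>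
  right steps all masses are positive, as the likelihood ratio requires.\<close>

lemma urn_comparison:
  fixes F :: "nat \<Rightarrow> real"
  assumes "A > 0" "B \<ge> 1" "A \<le> A'" "d' \<le> d"
    and F: "antimono F" "\<And>k. 0 \<le> F k" "\<And>k. F k \<le> 1"
  shows "measure_pmf.expectation (urn_pmf A B (Suc d)) F \<le> measure_pmf.expectation (urn_pmf A' 1 (Suc d')) F"
proof (rule monotone_likelihood_ratio[OF _ _ F])
  have pos: "pmf (urn_pmf A B (Suc d)) k > 0" if "A > 0" "B > 0" for A B d k
    using that unfolding pmf_urn[OF that]
    by (intro divide_pos_pos mult_pos_pos pochhammer_pos) auto
  show "pmf (urn_pmf A' 1 (Suc d')) k > 0" for k using assms by (intro pos) auto
  have ratio: "pmf (urn_pmf A B (Suc d)) (Suc k) = pmf (urn_pmf A B (Suc d)) k *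
      ((real (Suc d + k) / real (Suc k)) * ((B + real k) / (A + B + real (Suc d + k))))"
    if "A > 0" "B > 0" for A B d k
  proof -
    have "Suc k * (Suc (d + k) choose Suc k) = Suc (d + k) * (d + k choose k)"
      using Suc_times_binomial_eq[of "d + k" k] by (simp only: mult_ac)
    then have "real (Suc k) * real (Suc (d + k) choose Suc k) = real (Suc (d + k)) * real (d + k choose k)"
      by (metis of_nat_mult)
    then have c: "real (d + Suc k choose Suc k) = real (Suc d + k) / real (Suc k) * real (d + k choose k)"
      by (simp add: field_simps del: binomial_Suc_Suc)
    have P: "pochhammer (A + B) (Suc d + Suc k) = pochhammer (A + B) (Suc d + k) * (A + B + real (Suc d + k))"
      using pochhammer_Suc[of "A + B" "Suc d + k"] by simp
    have arrange: "x1 / x2 * x3 * x4 * (x5 * x6) / (x7 * x8) = x3 * x4 * x5 / x7 * (x1 / x2 * (x6 / x8))"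
      for x1 x2 x3 x4 x5 x6 x7 x8 :: real by (simp add: mult_ac)
    show ?thesis unfolding pmf_urn[OF that] c P pochhammer_Suc[of B]
      by (rule arrange)
  qed
  fix k
  let ?r = "\<lambda>A B d. (real (Suc d + k) / real (Suc k)) * ((B + real k) / (A + B + real (Suc d + k)))"
  have "(1 + real k) / (A' + 1 + real (Suc d' + k)) * real (Suc d' + k)
       \<le> (1 + real k) / (A + 1 + real (Suc d + k)) * real (Suc d + k)"
  proof -
    have "real (Suc d' + k) / (A' + 1 + real (Suc d' + k)) \<le> real (Suc d' + k) / (A + 1 + real (Suc d' + k))"
      using assms by (intro divide_left_mono mult_pos_pos) auto
    also have "\<dots> \<le> real (Suc d + k) / (A + 1 + real (Suc d + k))"
      using assms by (intro frac_mono) auto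
    finally have "(1 + real k) * (real (Suc d' + k) / (A' + 1 + real (Suc d' + k)))
        \<le> (1 + real k) * (real (Suc d + k) / (A + 1 + real (Suc d + k)))"
      by (rule mult_left_mono) simp
    then show ?thesis by simp
  qed
  also have "\<dots> \<le> (B + real k) / (A + B + real (Suc d + k)) * real (Suc d + k)"
    using frac_mono[of "A + real (Suc d)" "1 + real k" "B + real k"] assms
    by (intro mult_right_mono) (simp_all add: add_ac)
  finally have "(1 + real k) / (A' + 1 + real (Suc d' + k)) * real (Suc d' + k) / real (Suc k)
       \<le> (B + real k) / (A + B + real (Suc d + k)) * real (Suc d + k) / real (Suc k)"
    by (rule divide_right_mono) simp
  moreover have swap: "x / s * y = y * x / s" for x y s :: real by simp
  ultimately have r: "?r A' 1 d' \<le> ?r A B d"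
    by (simp only: swap[of "real (Suc d + k)"] swap[of "real (Suc d' + k)"])
  have pn: "pmf (urn_pmf A B (Suc d)) k * pmf (urn_pmf A' 1 (Suc d')) k \<ge> 0" by simp
  have "pmf (urn_pmf A' 1 (Suc d')) (Suc k) = pmf (urn_pmf A' 1 (Suc d')) k * ?r A' 1 d'"
    "pmf (urn_pmf A B (Suc d)) (Suc k) = pmf (urn_pmf A B (Suc d)) k * ?r A B d"
    using assms by (intro ratio; simp)+
  then show "pmf (urn_pmf A B (Suc d)) k * pmf (urn_pmf A' 1 (Suc d')) (Suc k)
      \<le> pmf (urn_pmf A B (Suc d)) (Suc k) * pmf (urn_pmf A' 1 (Suc d')) k"
    using mult_left_mono[OF r pn] by (simp only: mult_ac)
qed


section \<open>Site chains and nearest-neighbour paths\<close>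

text \<open>The sites \<open>x, x - 1, \<dots>, x - j + 1\<close> of a nearest-neighbour walk are processed from right to left,
  given the numbers \<open>l\<close> and \<open>r\<close> of left and right steps made so far. The state \<open>(s, z)\<close> consists of the
  total number \<open>s\<close> of left steps from the processed sites and the number \<open>z\<close> of left steps from the
  last one, counted up to the hitting time of a level to the right. By then, a site \<open>x\<close> below that
  level has been left to the right \<open>z + 1\<close> times if \<open>x \<ge> 0\<close>, and \<open>z\<close> times if \<open>x < 0\<close>.\<close>

primrec chain :: "(int \<Rightarrow> real) \<Rightarrow> (int \<Rightarrow> real) \<Rightarrow> (int \<Rightarrow> nat) \<Rightarrow> (int \<Rightarrow> nat) \<Rightarrow>
    nat \<Rightarrow> int \<Rightarrow> nat \<times> nat \<Rightarrow> (nat \<times> nat) pmf" where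
  "chain al be l r 0 x sz = return_pmf sz"
| "chain al be l r (Suc j) x sz =
     bind_pmf (urn_pmf (al x + real (r x)) (be x + real (l x)) (snd sz + of_bool (0 \<le> x) - r x))
       (\<lambda>k. chain al be l r j (x - 1) (fst sz + l x + k, l x + k))"

lemma chain_cong:
  assumes "\<And>x'. x' \<le> x \<Longrightarrow> l x' = l' x' \<and> r x' = r' x'"
  shows "chain al be l r j x sz = chain al be l' r' j x sz"
  using assms
proof (induction j arbitrary: x sz)
  case (Suc j)
  have "chain al be l r j (x - 1) sz = chain al be l' r' j (x - 1) sz" for sz
    using Suc.prems by (intro Suc.IH) auto
  then show ?case using Suc.prems[of x] by simp
qed simp

text \<open>A step of the walk from \<open>y\<close> reveals one draw of the urn at
  \<open>y\<close>. The urns to the right of \<open>y\<close> are independent of this draw and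
  commute with it; those to the left do not read the counts at \<open>y\<close>.\<close>

lemma chain_step:
  fixes y :: int
  assumes pos: "al y > 0" "be y > 0"
    and flow: "r y + of_bool (y < 0) = l (y + 1)"
    and "l (x + 1) \<le> snd sz" "y \<le> x" "x - int j < y"
  shows "chain al be l r j x sz =
    bind_pmf (bernoulli_pmf ((al y + real (r y)) / ((al y + real (r y)) + (be y + real (l y)))))
      (\<lambda>b. if b then chain al be l (r(y := Suc (r y))) j x sz
           else chain al be (l(y := Suc (l y))) r j x sz)"
  using assms(4-)
proof (induction j arbitrary: x sz)
  case (Suc j)
  let ?A = "al y + real (r y)" and ?B = "be y + real (l y)"
  let ?r = "r(y := Suc (r y))" and ?l = "l(y := Suc (l y))"
  show ?case
  proof (cases "x = y")
    case False
    let ?u = "urn_pmf (al x + real (r x)) (be x + real (l x)) (snd sz + of_bool (0 \<le> x) - r x)"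
    let ?n = "\<lambda>k. (fst sz + l x + k, l x + k)"
    have "chain al be l r (Suc j) x sz = bind_pmf ?u (\<lambda>k.
       bind_pmf (bernoulli_pmf (?A / (?A + ?B)))
      (\<lambda>b. if b then chain al be l ?r j (x - 1) (?n k)
           else chain al be ?l r j (x - 1) (?n k)))"
      unfolding chain.simps using Suc.prems False by (intro bind_pmf_cong refl Suc.IH) auto
    also have "\<dots> = bind_pmf (bernoulli_pmf (?A / (?A + ?B))) (\<lambda>b. bind_pmf ?u
      (\<lambda>k. if b then chain al be l ?r j (x - 1) (?n k)
           else chain al be ?l r j (x - 1) (?n k)))"
      by (rule bind_commute_pmf)
    also have "\<dots> = bind_pmf (bernoulli_pmf (?A / (?A + ?B)))
      (\<lambda>b. if b then chain al be l ?r (Suc j) x sz else chain al be ?l r (Suc j) x sz)"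
      using False by (intro bind_pmf_cong refl) simp
    finally show ?thesis .
  next
    case True
    define d where "d = snd sz + of_bool (0 \<le> y) - Suc (r y)"
    \<comment> \<open>By \<open>flow\<close> at least
      \<open>of_bool (y < 0) + of_bool (0 \<le> y) = 1\<close> right step from \<open>y\<close> is
      outstanding, so the subtraction does not truncate and \<open>urn_step\<close> applies.\<close>
    have d: "snd sz + of_bool (0 \<le> x) - r x = Suc d"
      using flow Suc.prems(1) True by (auto simp: d_def of_bool_def split: if_splits)
    have AB: "?A > 0" "?B > 0" using pos by (auto intro: add_pos_nonneg)
    have cong: "chain al be l ?r j (x - 1) s = chain al be l r j (x - 1) s"
      "chain al be ?l r j (x - 1) s = chain al be l r j (x - 1) s" for s
      using True by (auto intro!: chain_cong)
    show ?thesis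
      unfolding chain.simps d unfolding True urn_step[OF AB] bind_assoc_pmf
      using cong True d_def d
      by (intro bind_pmf_cong refl) (auto simp: bind_map_pmf add_ac simp del: urn_pmf.simps)
  qed
qed auto

lemma set_chain: "sz' \<in> set_pmf (chain al be l r j x sz) \<Longrightarrow> fst sz' \<ge> fst sz + (\<Sum>i<j. l (x - int i))"
proof (induction j arbitrary: x sz)
  case (Suc j)
  from Suc.prems obtain k where
    "sz' \<in> set_pmf (chain al be l r j (x - 1) (fst sz + l x + k, l x + k))" by auto
  from Suc.IH[OF this] have "fst sz' \<ge> fst sz + l x + (\<Sum>i<j. l (x - int (Suc i)))"
    by (simp add: algebra_simps)
  then show ?case by (simp add: sum.lessThan_Suc_shift del: sum.lessThan_Suc)
qed auto

text \<open>These are the counts at the moment of a hit: no site owes a further right step, so every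
  urn is asked for 0 right draws and the chain is deterministic.\<close>

lemma chain_finished:
  assumes "\<And>x'. x' \<le> x \<Longrightarrow> l (x' + 1) + of_bool (0 \<le> x') = r x'" "snd sz = l (x + 1)"
  shows "\<exists>z. chain al be l r j x sz = return_pmf (fst sz + (\<Sum>i<j. l (x - int i)), z)"
  using assms
proof (induction j arbitrary: x sz)
  case 0
  then show ?case by (cases sz) auto
next
  case (Suc j)
  have "chain al be l r (Suc j) x sz = chain al be l r j (x - 1) (fst sz + l x, l x)"
    using Suc.prems(1)[of x] Suc.prems(2) by (simp add: bind_return_pmf)
  moreover have "\<exists>z. chain al be l r j (x - 1) (fst sz + l x, l x) =
      return_pmf (fst (fst sz + l x, l x) + (\<Sum>i<j. l (x - 1 - int i)), z)"
    using Suc.prems by (intro Suc.IH) auto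
  moreover have "(\<Sum>i<Suc j. l (x - int i)) = l x + (\<Sum>i<j. l (x - 1 - int i))"
    unfolding sum.lessThan_Suc_shift by (simp add: algebra_simps)
  ultimately show ?case by (simp add: add.assoc del: sum.lessThan_Suc)
qed

section \<open>Step counts of nearest-neighbour paths\<close>

definition rights :: "(nat \<Rightarrow> int) \<Rightarrow> nat \<Rightarrow> int \<Rightarrow> nat" where
  "rights x n z = (\<Sum>i<n. of_bool (x i = z \<and> x (Suc i) = z + 1))"

definition lefts :: "(nat \<Rightarrow> int) \<Rightarrow> nat \<Rightarrow> int \<Rightarrow> nat" where
  "lefts x n z = (\<Sum>i<n. of_bool (x i = z \<and> x (Suc i) = z - 1))"

definition nn_path :: "(nat \<Rightarrow> int) \<Rightarrow> nat \<Rightarrow> bool" where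
  "nn_path x n \<longleftrightarrow> x 0 = 0 \<and> (\<forall>i<n. x (Suc i) = x i + 1 \<or> x (Suc i) = x i - 1)"

lemma nn_path_Suc: "nn_path x (Suc n) \<longleftrightarrow> nn_path x n \<and> (x (Suc n) = x n + 1 \<or> x (Suc n) = x n - 1)"
  by (auto simp: nn_path_def less_Suc_eq)

lemma rights_Suc: "rights x (Suc n) z = rights x n z + of_bool (x n = z \<and> x (Suc n) = z + 1)"
  and lefts_Suc: "lefts x (Suc n) z = lefts x n z + of_bool (x n = z \<and> x (Suc n) = z - 1)"
  by (simp_all add: rights_def lefts_def)

text \<open>Crossings of an edge alternate in direction, so the two counts differ by at most one,
  and they differ exactly when the edge separates 0 from the present position.\<close>

lemma rights_lefts_flow:
  assumes "nn_path x n"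
  shows "int (rights x n z) = int (lefts x n (z + 1)) + of_bool (0 \<le> z \<and> z < x n) - of_bool (x n \<le> z \<and> z < 0)"
  using assms
proof (induction n)
  case 0
  then show ?case by (simp add: rights_def lefts_def nn_path_def)
next
  case (Suc n)
  then show ?case by (auto simp: nn_path_Suc rights_Suc lefts_Suc)
qed

lemma rights_flow_nat:
  assumes "nn_path x n"
  shows "rights x n (x n) + of_bool (x n < 0) = lefts x n (x n + 1)"
  using rights_lefts_flow[OF assms, of "x n"] by (auto split: if_splits)

lemma nn_path_ge: "nn_path x n \<Longrightarrow> x n \<ge> - int n"
  by (induction n) (auto simp: nn_path_Suc nn_path_def)

text \<open>A path of length \<open>n\<close> ending at \<open>x n\<close> has made
  \<open>(n - x n) / 2\<close> left steps, and all sites left before time \<open>n\<close> lie in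
  the range \<open>- B, ..., N - 1\<close> of the sum.\<close>

lemma sum_lefts:
  assumes "nn_path x n" "\<And>i. i < n \<Longrightarrow> x i < N" "int n \<le> B"
  shows "x n + 2 * int (\<Sum>i<nat (N + B). lefts x n (N - 1 - int i)) = int n"
  using assms
proof (induction n)
  case 0
  then show ?case by (simp add: lefts_def nn_path_def)
next
  case (Suc n)
  have IH: "x n + 2 * int (\<Sum>i<nat (N + B). lefts x n (N - 1 - int i)) = int n"
    using Suc.prems by (intro Suc.IH) (auto simp: nn_path_Suc)
  have x: "x n < N" "x n > - B" using Suc.prems nn_path_ge[of x n] by (auto simp: nn_path_Suc)
  have "(\<Sum>i<nat (N + B). of_bool (x n = N - 1 - int i)) = (\<Sum>i<nat (N + B). if i = nat (N - 1 - x n) then 1 else 0 :: nat)"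
    using x by (intro sum.cong) auto
  also have "\<dots> = 1" using x by simp
  finally have 1: "(\<Sum>i<nat (N + B). of_bool (x n = N - 1 - int i)) = (1 :: nat)" .
  have "(\<Sum>i<nat (N + B). lefts x (Suc n) (N - 1 - int i)) = (\<Sum>i<nat (N + B). lefts x n (N - 1 - int i))
     + (if x (Suc n) = x n - 1 then (\<Sum>i<nat (N + B). of_bool (x n = N - 1 - int i)) else 0)"
    unfolding lefts_Suc sum.distrib by (auto intro!: sum.cong sum.neutral arg_cong[of _ _ card])
  then show ?case using IH 1 Suc.prems(1) by (auto simp: nn_path_Suc)
qed


section \<open>The law of hitting times\<close>

lemma measure_bind_bernoulli:
  assumes "0 \<le> p" "p \<le> 1"
  shows "measure_pmf.prob (bind_pmf (bernoulli_pmf p) f) S =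
    p * measure_pmf.prob (f True) S + (1 - p) * measure_pmf.prob (f False) S"
proof -
  have "ennreal (measure_pmf.prob (bind_pmf (bernoulli_pmf p) f) S) =
     ennreal (p * measure_pmf.prob (f True) S + (1 - p) * measure_pmf.prob (f False) S)"
    using assms
    by (simp add: emeasure_bind_pmf measure_pmf.emeasure_eq_measure[symmetric] ennreal_mult mult.commute
      flip: measure_pmf.emeasure_eq_measure)
  then show ?thesis using assms by (subst (asm) ennreal_inj) auto
qed

text \<open>In contrast to the biased walk this class is closed under reflection. Only
  nearest-neighbour histories occur in the rule because the flow identity behind the urns holds for
  these.\<close>

locale urn_walk = prob_space M
  for M :: "'a measure" and X :: "nat \<Rightarrow> 'a \<Rightarrow> int" and al be :: "int \<Rightarrow> real" +
  assumes rv: "random_variable (count_space UNIV) (X n)"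
    and start: "AE \<omega> in M. X 0 \<omega> = 0"
    and nearest_neighbour: "AE \<omega> in M. \<forall>n. X (Suc n) \<omega> = X n \<omega> + 1 \<or> X (Suc n) \<omega> = X n \<omega> - 1"
    and al_pos: "al z > 0" and be_pos: "be z > 0"
    and step: "nn_path x n \<Longrightarrow> \<P>(\<omega> in M. \<forall>i\<le>n. X i \<omega> = x i) > 0 \<Longrightarrow>
       \<P>(\<omega> in M. X (Suc n) \<omega> = x n + 1 \<bar> \<forall>i\<le>n. X i \<omega> = x i) =
         (al (x n) + real (rights x n (x n))) /
         ((al (x n) + real (rights x n (x n))) + (be (x n) + real (lefts x n (x n))))"
begin

definition hist :: "nat \<Rightarrow> (nat \<Rightarrow> int) \<Rightarrow> 'a set" where
  "hist n x = {\<omega> \<in> space M. \<forall>i\<le>n. X i \<omega> = x i}"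

definition hit_by :: "int \<Rightarrow> nat \<Rightarrow> 'a set" where
  "hit_by N t = {\<omega> \<in> space M. \<exists>i\<le>t. X i \<omega> = N}"

lemma X_eq_sets [measurable]: "{\<omega> \<in> space M. X n \<omega> = c} \<in> events"
proof -
  have "X n -` {c} \<inter> space M \<in> events" by (rule measurable_sets[OF rv]) auto
  also have "X n -` {c} \<inter> space M = {\<omega> \<in> space M. X n \<omega> = c}" by auto
  finally show ?thesis .
qed

lemma hist_sets [measurable]: "hist n x \<in> events"
  unfolding hist_def by measurable

lemma hit_by_sets [measurable]: "hit_by N t \<in> events"
  unfolding hit_by_def by measurable

text \<open>The step rule multiplied by the probability of the history; in this form it extends to
  null histories, where both sides vanish.\<close>

lemma prob_hist_step:
  fixes x n
  defines "p \<equiv> (al (x n) + real (rights x n (x n))) /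
         ((al (x n) + real (rights x n (x n))) + (be (x n) + real (lefts x n (x n))))"
  assumes "nn_path x n" "E \<in> events"
  shows "prob (hist (Suc n) (x(Suc n := x n + 1))) = p * prob (hist n x)"
    and "prob (hist (Suc n) (x(Suc n := x n - 1))) = (1 - p) * prob (hist n x)"
    and "prob (hist n x \<inter> E) = prob (hist (Suc n) (x(Suc n := x n + 1)) \<inter> E)
           + prob (hist (Suc n) (x(Suc n := x n - 1)) \<inter> E)"
proof -
  have split: "prob (hist n x \<inter> E) = prob (hist (Suc n) (x(Suc n := x n + 1)) \<inter> E)
           + prob (hist (Suc n) (x(Suc n := x n - 1)) \<inter> E)" if [measurable]: "E \<in> events" for E
  proof -
    have "prob (hist n x \<inter> E) = prob (hist (Suc n) (x(Suc n := x n + 1)) \<inter> E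
           \<union> hist (Suc n) (x(Suc n := x n - 1)) \<inter> E)"
    proof (intro finite_measure_eq_AE)
      have "AE \<omega> in M. X (Suc n) \<omega> = X n \<omega> + 1 \<or> X (Suc n) \<omega> = X n \<omega> - 1"
        using nearest_neighbour by (auto elim!: eventually_mono)
      then show "AE \<omega> in M. (\<omega> \<in> hist n x \<inter> E) = (\<omega> \<in> hist (Suc n) (x(Suc n := x n + 1)) \<inter> E
           \<union> hist (Suc n) (x(Suc n := x n - 1)) \<inter> E)"
        by eventually_elim (auto simp: hist_def le_Suc_eq)
    qed auto
    also have "\<dots> = prob (hist (Suc n) (x(Suc n := x n + 1)) \<inter> E)
           + prob (hist (Suc n) (x(Suc n := x n - 1)) \<inter> E)"
      by (intro finite_measure_Union) (auto simp: hist_def)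
    finally show ?thesis .
  qed
  show "prob (hist n x \<inter> E) = prob (hist (Suc n) (x(Suc n := x n + 1)) \<inter> E)
           + prob (hist (Suc n) (x(Suc n := x n - 1)) \<inter> E)" by (rule split) fact
  have le: "prob (hist (Suc n) (x(Suc n := c))) \<le> prob (hist n x)" for c
    by (intro finite_measure_mono) (auto simp: hist_def)
  show 1: "prob (hist (Suc n) (x(Suc n := x n + 1))) = p * prob (hist n x)"
  proof (cases "prob (hist n x) > 0")
    case True
    have "p = \<P>(\<omega> in M. X (Suc n) \<omega> = x n + 1 \<bar> \<forall>i\<le>n. X i \<omega> = x i)"
      unfolding p_def using True by (intro step[symmetric] assms) (auto simp: hist_def)
    also have "\<dots> = prob (hist (Suc n) (x(Suc n := x n + 1))) / prob (hist n x)"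
      unfolding cond_prob_def hist_def
      by (intro arg_cong2[of _ _ _ _ "(/)"] arg_cong[of _ _ prob]) (auto simp: le_Suc_eq)
    finally show ?thesis using True by simp
  next
    case False
    then have "prob (hist n x) = 0" using zero_less_measure_iff by blast
    then show ?thesis using le[of "x n + 1"] by (simp add: measure_le_0_iff)
  qed
  have "prob (hist n x) = prob (hist (Suc n) (x(Suc n := x n + 1))) + prob (hist (Suc n) (x(Suc n := x n - 1)))"
    using split[of "space M"] by (simp add: hist_def)
  then show "prob (hist (Suc n) (x(Suc n := x n - 1))) = (1 - p) * prob (hist n x)"
    unfolding 1 by (simp add: algebra_simps)
qed

text \<open>Backward induction on time: by \<open>prob_hist_step\<close> and
  \<open>chain_step\<close> both sides obey the same one-step equation, and they agree when the time
  is used up or \<open>N\<close> is hit.\<close>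

lemma prob_hist_hit:
  assumes "n \<le> t" "nn_path x n" "\<And>i. i \<le> n \<Longrightarrow> x i < N" "int t \<le> B"
  shows "prob (hist n x \<inter> hit_by N t) = prob (hist n x) *
     measure_pmf.prob (chain al be (lefts x n) (rights x n) (nat (N + B)) (N - 1) (0, 0))
       {sz. N + 2 * int (fst sz) \<le> int t}"
  using assms
proof (induction "t - n" arbitrary: n x)
  case 0
  have "hist n x \<inter> hit_by N t = {}"
    using 0 by (force simp: hist_def hit_by_def)
  \<comment> \<open>The left steps already made give \<open>x n + 2 * s \<ge> n = t\<close>, and the
    path is still below \<open>N\<close>, so \<open>N + 2 * s > t\<close>.\<close>
  moreover have "set_pmf (chain al be (lefts x n) (rights x n) (nat (N + B)) (N - 1) (0, 0)) \<inter>
      {sz. N + 2 * int (fst sz) \<le> int t} = {}"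
  proof (intro equalityI subsetI; clarify)
    fix s z
    assume "(s, z) \<in> set_pmf (chain al be (lefts x n) (rights x n) (nat (N + B)) (N - 1) (0, 0))"
    from set_chain[OF this] have "int s \<ge> int (\<Sum>i<nat (N + B). lefts x n (N - 1 - int i))"
      by (simp only: fst_conv add_0 of_nat_le_iff)
    moreover have "x n + 2 * int (\<Sum>i<nat (N + B). lefts x n (N - 1 - int i)) = int n"
      using 0 by (intro sum_lefts) auto
    moreover assume "N + 2 * int (fst (s, z)) \<le> int t"
    ultimately show "(s, z) \<in> {}" using 0(1) 0(2) 0(4)[of n] by simp
  qed
  ultimately show ?case by (simp add: measure_pmf_zero_iff)
next
  case (Suc k)
  let ?W = "\<lambda>x n. measure_pmf.prob (chain al be (lefts x n) (rights x n) (nat (N + B)) (N - 1) (0, 0))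
       {sz. N + 2 * int (fst sz) \<le> int t}"
  let ?R = "x(Suc n := x n + 1)" and ?L = "x(Suc n := x n - 1)"
  let ?A = "al (x n) + real (rights x n (x n))" and ?B = "be (x n) + real (lefts x n (x n))"
  have n: "n < t" using Suc.hyps(2) by simp
  have upd: "rights x' n = rights x n" "lefts x' n = lefts x n" if "\<And>i. i \<le> n \<Longrightarrow> x' i = x i" for x'
    using that by (auto simp: rights_def lefts_def fun_eq_iff intro!: sum.cong)
  have nn: "nn_path ?R (Suc n)" "nn_path ?L (Suc n)" using Suc.prems(2) by (auto simp: nn_path_def less_Suc_eq)
  have cnt: "rights ?R (Suc n) = (rights x n)(x n := Suc (rights x n (x n)))" "lefts ?R (Suc n) = lefts x n"
    "rights ?L (Suc n) = rights x n" "lefts ?L (Suc n) = (lefts x n)(x n := Suc (lefts x n (x n)))"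
    using upd[of ?R] upd[of ?L] by (simp_all add: fun_eq_iff rights_Suc lefts_Suc)
  have AB: "?A > 0" "?B > 0" using al_pos be_pos by (auto intro: add_pos_nonneg)
  have xge: "x n > - B" using nn_path_ge[OF Suc.prems(2)] n Suc.prems(4) by simp
  have xlt: "x n < N" using Suc.prems(3) by simp
  then have xlt': "x n - 1 < N" by simp
  have "chain al be (lefts x n) (rights x n) (nat (N + B)) (N - 1) (0, 0) =
    bind_pmf (bernoulli_pmf (?A / (?A + ?B)))
      (\<lambda>b. if b then chain al be (lefts x n) ((rights x n)(x n := Suc (rights x n (x n)))) (nat (N + B)) (N - 1) (0, 0)
           else chain al be ((lefts x n)(x n := Suc (lefts x n (x n)))) (rights x n) (nat (N + B)) (N - 1) (0, 0))"
  proof (intro chain_step al_pos be_pos rights_flow_nat Suc.prems)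
    \<comment> \<open>The chain starts from 0 left steps out of \<open>N\<close>, which fits the
      history because \<open>N\<close> has not been visited.\<close>
    have "x i \<noteq> N" if "i < n" for i using Suc.prems(3)[of i] that by simp
    then show "lefts x n (N - 1 + 1) \<le> snd (0, 0)" by (auto simp: lefts_def)
  qed (use xge xlt in auto)
  then have W: "?W x n = ?A / (?A + ?B) * ?W ?R (Suc n) + (1 - ?A / (?A + ?B)) * ?W ?L (Suc n)"
    unfolding cnt using AB by (simp add: measure_bind_bernoulli)
  have L: "prob (hist (Suc n) ?L \<inter> hit_by N t) = prob (hist (Suc n) ?L) * ?W ?L (Suc n)"
    using Suc.hyps(2) Suc.prems(1,3,4) xlt' by (intro Suc.hyps(1) nn) (auto simp: le_Suc_eq)
  have R: "prob (hist (Suc n) ?R \<inter> hit_by N t) = prob (hist (Suc n) ?R) * ?W ?R (Suc n)"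
  proof (cases "x n + 1 < N")
    case True
    then show ?thesis
      using Suc.hyps(2) Suc.prems by (intro Suc.hyps(1) nn) (auto simp: le_Suc_eq)
  next
    case False
    then have N: "N = x n + 1" using xlt by simp
    have "hist (Suc n) ?R \<inter> hit_by N t = hist (Suc n) ?R"
      using n N by (auto simp: hist_def hit_by_def intro!: exI[of _ "Suc n"])
    \<comment> \<open>The right step hits \<open>N\<close> at time \<open>Suc n \<le> t\<close>; the
      chain has nothing left to draw and returns exactly the left steps made.\<close>
    moreover have "?W ?R (Suc n) = 1"
    proof -
      have "\<exists>z. chain al be (lefts ?R (Suc n)) (rights ?R (Suc n)) (nat (N + B)) (N - 1) (0, 0) =
         return_pmf (fst (0::nat, 0::nat) + (\<Sum>i<nat (N + B). lefts ?R (Suc n) (N - 1 - int i)), z)"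
      proof (rule chain_finished)
        fix x' assume "x' \<le> N - 1"
        then show "lefts ?R (Suc n) (x' + 1) + of_bool (0 \<le> x') = rights ?R (Suc n) x'"
          using rights_lefts_flow[OF nn(1), of x'] N by (auto split: if_splits)
      next
        have "?R i \<noteq> N" if "i < Suc n" for i using Suc.prems(3)[of i] that by simp
        then show "snd (0::nat, 0::nat) = lefts ?R (Suc n) (N - 1 + 1)" by (auto simp: lefts_def)
      qed
      moreover have "?R (Suc n) + 2 * int (\<Sum>i<nat (N + B). lefts ?R (Suc n) (N - 1 - int i)) = int (Suc n)"
        using n Suc.prems by (intro sum_lefts nn) auto
      ultimately show ?thesis using n N by auto
    qed
    ultimately show ?thesis by simp
  qed
  note S = prob_hist_step[OF Suc.prems(2) hit_by_sets]
  show ?case unfolding S(3) L R S(1,2) W by (simp add: algebra_simps)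
qed

text \<open>The condition on \<open>s\<close> says that the hitting time of \<open>N\<close>, being \<open>N\<close> plus twice the number of left
  steps, is at most \<open>t\<close>. Sites below \<open>- B\<close> are out of reach by time \<open>t\<close>.\<close>

lemma prob_hit_by:
  assumes "N > 0" "int t \<le> B"
  shows "prob (hit_by N t) = measure_pmf.prob (chain al be (\<lambda>_. 0) (\<lambda>_. 0) (nat (N + B)) (N - 1) (0, 0))
       {sz. N + 2 * int (fst sz) \<le> int t}"
proof -
  have "prob (hist 0 (\<lambda>_. 0)) = prob (space M)"
    using start by (intro finite_measure_eq_AE) (auto simp: hist_def elim!: eventually_mono)
  then have 1: "prob (hist 0 (\<lambda>_. 0)) = 1" by (simp add: prob_space)
  have "prob (hit_by N t) = prob (hist 0 (\<lambda>_. 0) \<inter> hit_by N t)"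
    using start by (intro finite_measure_eq_AE) (auto simp: hist_def hit_by_def elim!: eventually_mono)
  also have "\<dots> = measure_pmf.prob (chain al be (lefts (\<lambda>_. 0) 0) (rights (\<lambda>_. 0) 0) (nat (N + B)) (N - 1) (0, 0))
       {sz. N + 2 * int (fst sz) \<le> int t}"
    using assms by (subst prob_hist_hit[where B = B]) (auto simp: nn_path_def 1)
  also have "lefts (\<lambda>_. 0) 0 = (\<lambda>_. 0)" by (auto simp: lefts_def)
  also have "rights (\<lambda>_. 0) 0 = (\<lambda>_. 0)" by (auto simp: rights_def)
  finally show ?thesis .
qed

end


section \<open>The homogeneous chain\<close>

lemma measure_bind_pmf:
  "measure_pmf.prob (bind_pmf p f) S = measure_pmf.expectation p (\<lambda>x. measure_pmf.prob (f x) S)"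
proof -
  have "ennreal (measure_pmf.prob (bind_pmf p f) S) = (\<integral>\<^sup>+x. ennreal (measure_pmf.prob (f x) S) \<partial>p)"
    by (simp add: emeasure_bind_pmf flip: measure_pmf.emeasure_eq_measure)
  also have "\<dots> = ennreal (measure_pmf.expectation p (\<lambda>x. measure_pmf.prob (f x) S))"
    by (intro nn_integral_eq_integral measure_pmf.integrable_const_bound[of _ 1]) auto
  finally show ?thesis by (simp add: integral_nonneg_AE)
qed

text \<open>The part of the chain on the positive sites, where all urns are alike. By de Finetti it
  is a branching process with one immigrant per generation in an independent beta environment; the
  immigrant is the \<open>Suc\<close>.\<close>

primrec hom_chain :: "real \<Rightarrow> real \<Rightarrow> nat \<Rightarrow> nat \<times> nat \<Rightarrow> (nat \<times> nat) pmf" where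
  "hom_chain A B 0 sz = return_pmf sz"
| "hom_chain A B (Suc j) sz =
     bind_pmf (urn_pmf A B (Suc (snd sz))) (\<lambda>k. hom_chain A B j (fst sz + k, k))"

text \<open>Splitting off the last site instead of the first lets an induction add one increment to
  a chain whose moments are already bounded.\<close>

lemma hom_chain_Suc':
  "hom_chain A B (Suc j) sz =
     bind_pmf (hom_chain A B j sz) (\<lambda>sz. map_pmf (\<lambda>k. (fst sz + k, k)) (urn_pmf A B (Suc (snd sz))))"
proof (induction j arbitrary: sz)
  case 0
  then show ?case by (simp add: bind_return_pmf map_pmf_def del: urn_pmf.simps)
next
  case (Suc j)
  have "hom_chain A B (Suc (Suc j)) sz =
      bind_pmf (urn_pmf A B (Suc (snd sz))) (\<lambda>k. hom_chain A B (Suc j) (fst sz + k, k))"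
    by (rule hom_chain.simps(2))
  also have "\<dots> = bind_pmf (urn_pmf A B (Suc (snd sz))) (\<lambda>k. bind_pmf (hom_chain A B j (fst sz + k, k))
      (\<lambda>sz. map_pmf (\<lambda>k. (fst sz + k, k)) (urn_pmf A B (Suc (snd sz)))))"
    by (intro bind_pmf_cong refl Suc.IH)
  also have "\<dots> = bind_pmf (hom_chain A B (Suc j) sz)
      (\<lambda>sz. map_pmf (\<lambda>k. (fst sz + k, k)) (urn_pmf A B (Suc (snd sz))))"
    by (simp only: hom_chain.simps(2) bind_assoc_pmf)
  finally show ?case .
qed

lemma hom_chain_comparison:
  assumes "0 < A" "A \<le> A'" "1 \<le> B" "s' \<le> s" "z' \<le> z"
  shows "measure_pmf.prob (hom_chain A B j (s, z)) {sz. fst sz \<le> m} \<le>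
    measure_pmf.prob (hom_chain A' 1 j (s', z')) {sz. fst sz \<le> m}"
  using assms
proof (induction j arbitrary: A B s s' z z')
  case 0
  then show ?case by (auto simp: indicator_def)
next
  case (Suc j)
  let ?F = "\<lambda>k. measure_pmf.prob (hom_chain A' 1 j (s' + k, k)) {sz. fst sz \<le> m}"
  have bd: "?F k \<le> 1" "0 \<le> ?F k" for k by auto
  \<comment> \<open>This is the induction hypothesis with the same chain on both sides and two
    different starting states.\<close>
  have "antimono ?F"
    using Suc.prems by (intro antimonoI Suc.IH) auto
  have "measure_pmf.prob (hom_chain A B (Suc j) (s, z)) {sz. fst sz \<le> m} =
      measure_pmf.expectation (urn_pmf A B (Suc z)) (\<lambda>k. measure_pmf.prob (hom_chain A B j (s + k, k)) {sz. fst sz \<le> m})"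
    by (simp add: measure_bind_pmf del: urn_pmf.simps)
  also have "\<dots> \<le> measure_pmf.expectation (urn_pmf A B (Suc z)) ?F"
    using Suc.prems by (intro integral_mono measure_pmf.integrable_const_bound[of _ 1] Suc.IH) auto
  also have "\<dots> \<le> measure_pmf.expectation (urn_pmf A' 1 (Suc z')) ?F"
    using Suc.prems \<open>antimono ?F\<close> bd by (intro urn_comparison) auto
  also have "\<dots> = measure_pmf.prob (hom_chain A' 1 (Suc j) (s', z')) {sz. fst sz \<le> m}"
    by (simp add: measure_bind_pmf del: urn_pmf.simps)
  finally show ?case .
qed

text \<open>For \<open>a > 1\<close> these are the masses of \<open>geo_pmf (a - 1) 1\<close> times
  \<open>a / (a - 1)\<close>. Being of order \<open>k powr - a\<close>, they have moments of the
  orders below \<open>a - 1\<close>.\<close>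

definition rev_weight :: "real \<Rightarrow> nat \<Rightarrow> real" where
  "rev_weight a k = fact k / pochhammer (a + 1) k"

lemma rev_weight_pos: "a > 0 \<Longrightarrow> rev_weight a k > 0"
  unfolding rev_weight_def by (intro divide_pos_pos pochhammer_pos) auto

text \<open>Multiplying by \<open>rev_weight a m\<close> turns the factors of \<open>pmf_urn\<close>
  that depend on \<open>m\<close> alone into \<open>fact m\<close>, and leaves an expression
  symmetric in \<open>m\<close> and \<open>k\<close>.\<close>

lemma rev_weight_reversible:
  assumes "a > 0"
  shows "rev_weight a m * pmf (urn_pmf a 1 (Suc m)) k = rev_weight a k * pmf (urn_pmf a 1 (Suc k)) m"
proof -
  have p: "pochhammer (a + 1) n \<noteq> 0" for n using pochhammer_pos[of "a + 1" n] assms by auto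
  have "rev_weight a m * pmf (urn_pmf a 1 (Suc m)) k =
      fact m * fact k * real (m + k choose k) * a / pochhammer (a + 1) (Suc m + k)" for m k
    unfolding pmf_urn[OF assms zero_less_one] rev_weight_def pochhammer_rec[of a m] pochhammer_fact[symmetric]
    using p[of m] by (simp add: mult_ac)
  moreover have "m + k choose k = k + m choose m"
    using binomial_symmetric[of k "m + k"] by (simp add: add.commute)
  ultimately show ?thesis by (simp add: add.commute mult_ac)
qed

text \<open>A bound on the convergent \<open>Gamma_series a\<close> makes the terms
  \<open>O(k powr (q - a))\<close>, with exponent below -1.\<close>

lemma rev_weight_summable:
  assumes "q \<ge> 0" "q < a - 1"
  shows "summable (\<lambda>k. rev_weight a k * (real k + 1) powr q)"
proof -
  have a: "a > 1" using assms by simp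
  have "convergent (Gamma_series a)"
    using Gamma_series_LIMSEQ by (auto simp: convergent_def)
  then have "Bseq (Gamma_series a)" by (rule convergent_imp_Bseq)
  then obtain K where K: "K > 0" "\<And>k. norm (Gamma_series a k) \<le> K" by (auto simp: Bseq_def)
  have "rev_weight a k * (real k + 1) powr q \<le> a * K * 2 powr q * real k powr (q - a)" if "k \<ge> 1" for k
  proof -
    have "pochhammer a (Suc k) = a * pochhammer (a + 1) k" by (rule pochhammer_rec)
    then have "rev_weight a k = a * Gamma_series a k * real k powr - a"
      using a that by (simp add: rev_weight_def Gamma_series_def powr_def exp_minus field_simps del: pochhammer_Suc)
    also have "\<dots> \<le> a * K * real k powr - a"
      using K(2)[of k] a by (intro mult_right_mono mult_left_mono) auto
    finally have 1: "rev_weight a k \<le> a * K * real k powr - a" .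
    have 2: "(real k + 1) powr q \<le> (2 * real k) powr q"
      using that assms by (intro powr_mono2) auto
    have "rev_weight a k * (real k + 1) powr q \<le> (a * K * real k powr - a) * (2 * real k) powr q"
      using 1 2 a K(1) by (intro mult_mono) auto
    also have "\<dots> = a * K * 2 powr q * real k powr (q - a)"
      using that by (simp add: powr_mult powr_diff powr_minus field_simps)
    finally show ?thesis .
  qed
  then have "\<forall>\<^sub>F k in sequentially. norm (rev_weight a k * (real k + 1) powr q) \<le> a * K * 2 powr q * real k powr (q - a)"
    using rev_weight_pos[of a] a by (intro eventually_sequentiallyI[of 1]) (auto simp: abs_mult less_imp_le)
  then show ?thesis
    by (rule summable_comparison_test_ev) (use assms in \<open>auto intro!: summable_mult simp: summable_real_powr_iff\<close>)
qed

definition site_law :: "real \<Rightarrow> nat \<Rightarrow> nat pmf" where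
  "site_law a n = map_pmf snd (hom_chain a 1 n (0, 0))"

lemma site_law_Suc: "site_law a (Suc n) = bind_pmf (site_law a n) (\<lambda>z. urn_pmf a 1 (Suc z))"
  unfolding site_law_def hom_chain_Suc'
  by (simp add: map_bind_pmf bind_map_pmf pmf.map_comp o_def del: urn_pmf.simps hom_chain.simps)

text \<open>The chain is reversible with respect to \<open>rev_weight\<close>, and \<open>rev_weight 0 = 1\<close>.\<close>

lemma pmf_site_law_le:
  assumes "a > 0"
  shows "pmf (site_law a n) k \<le> rev_weight a k"
proof (induction n arbitrary: k)
  case 0
  then show ?case using rev_weight_pos[OF assms, of k] by (auto simp: site_law_def indicator_def rev_weight_def)
next
  case (Suc n)
  have "ennreal (pmf (site_law a (Suc n)) k) =
      (\<integral>\<^sup>+z. ennreal (pmf (urn_pmf a 1 (Suc z)) k) \<partial>site_law a n)"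
    unfolding site_law_Suc ennreal_pmf_bind ..
  also have "\<dots> = (\<integral>\<^sup>+z. ennreal (pmf (site_law a n) z) * ennreal (pmf (urn_pmf a 1 (Suc z)) k) \<partial>count_space UNIV)"
    by (simp add: nn_integral_measure_pmf del: urn_pmf.simps)
  also have "\<dots> \<le> (\<integral>\<^sup>+z. ennreal (rev_weight a k) * ennreal (pmf (urn_pmf a 1 (Suc k)) z) \<partial>count_space UNIV)"
  proof (rule nn_integral_mono)
    fix z
    have "pmf (site_law a n) z * pmf (urn_pmf a 1 (Suc z)) k \<le> rev_weight a z * pmf (urn_pmf a 1 (Suc z)) k"
      by (intro mult_right_mono Suc.IH) auto
    also have "\<dots> = rev_weight a k * pmf (urn_pmf a 1 (Suc k)) z" by (rule rev_weight_reversible[OF assms])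
    finally show "ennreal (pmf (site_law a n) z) * ennreal (pmf (urn_pmf a 1 (Suc z)) k) \<le>
       ennreal (rev_weight a k) * ennreal (pmf (urn_pmf a 1 (Suc k)) z)"
      using rev_weight_pos[OF assms, of k] by (simp add: ennreal_leI del: urn_pmf.simps flip: ennreal_mult)
  qed
  also have "\<dots> = ennreal (rev_weight a k)"
    by (simp add: nn_integral_cmult nn_integral_pmf del: urn_pmf.simps)
  finally show ?case using rev_weight_pos[OF assms, of k] by simp
qed

definition moment_bound :: "real \<Rightarrow> real \<Rightarrow> real" where
  "moment_bound a q = (\<Sum>k. rev_weight a k * (real k + 1) powr q)"

lemma moment_bound_nonneg:
  assumes "q \<ge> 0" "q < a - 1"
  shows "moment_bound a q \<ge> 0"
  unfolding moment_bound_def using assms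
  by (intro suminf_nonneg[OF rev_weight_summable[OF assms]] mult_nonneg_nonneg less_imp_le[OF rev_weight_pos]) auto

lemma moment_site_law_le:
  assumes "q \<ge> 0" "q < a - 1"
  shows "(\<integral>\<^sup>+z. ennreal ((real z + 1) powr q) \<partial>site_law a n) \<le> ennreal (moment_bound a q)"
proof -
  have a: "a > 0" using assms by simp
  have "(\<integral>\<^sup>+z. ennreal ((real z + 1) powr q) \<partial>site_law a n)
      = (\<integral>\<^sup>+z. ennreal (pmf (site_law a n) z) * ennreal ((real z + 1) powr q) \<partial>count_space UNIV)"
    by (simp add: nn_integral_measure_pmf)
  also have "\<dots> \<le> (\<integral>\<^sup>+z. ennreal (rev_weight a z * (real z + 1) powr q) \<partial>count_space UNIV)"
    using rev_weight_pos[OF a] pmf_site_law_le[OF a]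
    by (intro nn_integral_mono) (auto simp: less_imp_le intro!: ennreal_leI mult_right_mono simp flip: ennreal_mult)
  also have "\<dots> = ennreal (moment_bound a q)"
    unfolding moment_bound_def nn_integral_count_space_nat
    using rev_weight_pos[OF a] rev_weight_summable[OF assms] by (intro suminf_ennreal2) (auto simp: less_imp_le)
  finally show ?thesis .
qed

text \<open>This serves integrability, so a bound depending on \<open>z\<close> is enough: by
  reversibility the transition from \<open>z\<close> to \<open>k\<close> has mass at most
  \<open>rev_weight a k / rev_weight a z\<close>.\<close>

lemma urn_moment_finite:
  assumes "q \<ge> 0" "q < a - 1"
  shows "(\<integral>\<^sup>+k. ennreal ((real k + 1) powr q) \<partial>urn_pmf a 1 (Suc z)) < \<infinity>"
proof -
  have a: "a > 0" using assms by simp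
  have "(\<integral>\<^sup>+k. ennreal ((real k + 1) powr q) \<partial>urn_pmf a 1 (Suc z))
      = (\<integral>\<^sup>+k. ennreal (pmf (urn_pmf a 1 (Suc z)) k) * ennreal ((real k + 1) powr q) \<partial>count_space UNIV)"
    by (simp add: nn_integral_measure_pmf del: urn_pmf.simps)
  also have "\<dots> \<le> (\<integral>\<^sup>+k. ennreal (1 / rev_weight a z) * ennreal (rev_weight a k * (real k + 1) powr q) \<partial>count_space UNIV)"
  proof (rule nn_integral_mono)
    fix k
    have "rev_weight a z * pmf (urn_pmf a 1 (Suc z)) k \<le> rev_weight a k"
      unfolding rev_weight_reversible[OF a, of z k]
      using mult_left_mono[OF pmf_le_1 less_imp_le[OF rev_weight_pos[OF a]]] by simp
    then have "pmf (urn_pmf a 1 (Suc z)) k \<le> 1 / rev_weight a z * rev_weight a k"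
      using rev_weight_pos[OF a, of z] by (simp add: field_simps del: urn_pmf.simps)
    then have "pmf (urn_pmf a 1 (Suc z)) k * (real k + 1) powr q \<le> 1 / rev_weight a z * rev_weight a k * (real k + 1) powr q"
      by (rule mult_right_mono) simp
    then show "ennreal (pmf (urn_pmf a 1 (Suc z)) k) * ennreal ((real k + 1) powr q) \<le>
       ennreal (1 / rev_weight a z) * ennreal (rev_weight a k * (real k + 1) powr q)"
      using rev_weight_pos[OF a, of z] rev_weight_pos[OF a, of k]
      by (simp add: ennreal_leI mult.assoc less_imp_le del: urn_pmf.simps flip: ennreal_mult)
  qed
  also have "\<dots> = ennreal (1 / rev_weight a z) * ennreal (moment_bound a q)"
    unfolding moment_bound_def
    using rev_weight_pos[OF a] rev_weight_summable[OF assms]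
    by (simp add: nn_integral_cmult nn_integral_count_space_nat suminf_ennreal2 less_imp_le)
  also have "\<dots> < \<infinity>" by (simp add: ennreal_mult_less_top)
  finally show ?thesis .
qed


section \<open>A Taylor estimate for powers\<close>

text \<open>After division by \<open>x + y\<close> it follows from \<open>u \<le> u powr r\<close>
  on the unit interval.\<close>

lemma powr_subadditive:
  fixes x y r :: real
  assumes "0 \<le> x" "0 \<le> y" "0 < r" "r \<le> 1"
  shows "(x + y) powr r \<le> x powr r + y powr r"
proof (cases "x + y = 0")
  case False
  then have s: "x + y > 0" using assms by simp
  have *: "u / (x + y) \<le> (u / (x + y)) powr r" if "0 \<le> u" "u \<le> x + y" for u
    using powr_mono'[of r 1 "u / (x + y)"] that s assms by simp
  have "1 = x / (x + y) + y / (x + y)" using s by (simp add: add_divide_distrib[symmetric])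
  also have "\<dots> \<le> (x / (x + y)) powr r + (y / (x + y)) powr r"
    using assms by (intro add_mono *) auto
  also have "\<dots> = (x powr r + y powr r) / (x + y) powr r"
    using s assms by (simp add: powr_divide add_divide_distrib)
  finally show ?thesis using s by (simp add: pos_le_divide_eq)
qed (use assms in auto)

lemma powr_diff_le:
  fixes x y r :: real
  assumes "0 \<le> x" "0 \<le> y" "0 < r" "r \<le> 1"
  shows "\<bar>x powr r - y powr r\<bar> \<le> \<bar>x - y\<bar> powr r"
proof (cases "x \<le> y")
  case True
  then show ?thesis using powr_subadditive[of x "y - x" r] powr_mono2[of r x y] assms by simp
next
  case False
  then show ?thesis using powr_subadditive[of y "x - y" r] powr_mono2[of r y x] assms by simp
qed

text \<open>Hoelder continuity of the odd power. The factor 2 is for opposite signs, where the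
  moduli of \<open>x\<close> and \<open>y\<close> are both at most that of
  \<open>x - y\<close>.\<close>

lemma signed_powr_diff_le:
  fixes x y r :: real
  assumes "0 < r" "r \<le> 1"
  shows "\<bar>sgn x * \<bar>x\<bar> powr r - sgn y * \<bar>y\<bar> powr r\<bar> \<le> 2 * \<bar>x - y\<bar> powr r"
proof -
  consider "x \<ge> 0" "y \<ge> 0" | "x \<le> 0" "y \<le> 0" | "x < 0" "y > 0" | "x > 0" "y < 0" by linarith
  then show ?thesis
  proof cases
    case 1
    then have "sgn x * \<bar>x\<bar> powr r = x powr r" "sgn y * \<bar>y\<bar> powr r = y powr r" by (auto simp: sgn_if)
    then show ?thesis using powr_diff_le[of x y r] 1 assms by (smt (verit) powr_ge_zero)
  next
    case 2
    then have "sgn x * \<bar>x\<bar> powr r = - ((-x) powr r)" "sgn y * \<bar>y\<bar> powr r = - ((-y) powr r)" by (auto simp: sgn_if)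
    moreover have "\<bar>- x - - y\<bar> = \<bar>x - y\<bar>" by simp
    ultimately show ?thesis using powr_diff_le[of "-x" "-y" r] 2 assms by (smt (verit) powr_ge_zero)
  next
    case 3
    then have "sgn x * \<bar>x\<bar> powr r = - ((-x) powr r)" "sgn y * \<bar>y\<bar> powr r = y powr r" by (auto simp: sgn_if)
    moreover have "(-x) powr r \<le> \<bar>x - y\<bar> powr r" "y powr r \<le> \<bar>x - y\<bar> powr r"
      using 3 assms by (auto intro!: powr_mono2)
    ultimately show ?thesis by (smt (verit) powr_ge_zero)
  next
    case 4
    then have "sgn y * \<bar>y\<bar> powr r = - ((-y) powr r)" "sgn x * \<bar>x\<bar> powr r = x powr r" by (auto simp: sgn_if)
    moreover have "(-y) powr r \<le> \<bar>x - y\<bar> powr r" "x powr r \<le> \<bar>x - y\<bar> powr r"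
      using 4 assms by (auto intro!: powr_mono2)
    ultimately show ?thesis by (smt (verit) powr_ge_zero)
  qed
qed

lemma has_real_derivative_abs_powr:
  fixes x q :: real
  assumes "1 < q"
  shows "((\<lambda>x. \<bar>x\<bar> powr q) has_real_derivative q * (sgn x * \<bar>x\<bar> powr (q - 1))) (at x)"
proof -
  consider "x > 0" | "x < 0" | "x = 0" by linarith
  then show ?thesis
  proof cases
    case 1
    have "((\<lambda>x. x powr q) has_real_derivative q * x powr (q - 1)) (at x)"
      using 1 by (auto intro!: derivative_eq_intros)
    moreover have "\<forall>\<^sub>F y in nhds x. \<bar>y\<bar> powr q = y powr q"
      using eventually_nhds_in_open[of "{0<..}" x] 1 by (auto elim!: eventually_mono)
    ultimately show ?thesis using 1 by (subst DERIV_cong_ev[OF refl _ refl]) auto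
  next
    case 2
    have "((\<lambda>x. (-x) powr q) has_real_derivative - q * (-x) powr (q - 1)) (at x)"
      using 2 by (auto intro!: derivative_eq_intros)
    moreover have "\<forall>\<^sub>F y in nhds x. \<bar>y\<bar> powr q = (-y) powr q"
      using eventually_nhds_in_open[of "{..<0}" x] 2 by (auto elim!: eventually_mono)
    ultimately show ?thesis using 2 by (subst DERIV_cong_ev[OF refl _ refl]) auto
  next
    case 3
    \<comment> \<open>At 0 the difference quotient has modulus
      \<open>\<bar>h\<bar> powr (q - 1)\<close>, which tends to 0 because
      \<open>q > 1\<close>.\<close>
    have "((\<lambda>h::real. \<bar>h\<bar> powr (q - 1)) \<longlongrightarrow> 0) (at 0)"
      using assms by (intro tendsto_zero_powrI tendsto_rabs_zero) (auto intro!: tendsto_eq_intros)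
    then have "((\<lambda>h::real. \<bar>\<bar>h\<bar> powr q / h\<bar>) \<longlongrightarrow> 0) (at 0)"
      by (rule Lim_transform_eventually)
        (auto simp: eventually_at_filter powr_diff abs_divide)
    then have "((\<lambda>h::real. \<bar>h\<bar> powr q / h) \<longlongrightarrow> 0) (at 0)"
      by (rule tendsto_rabs_zero_cancel)
    then show ?thesis using 3 by (simp add: DERIV_def)
  qed
qed

text \<open>The mean value theorem and the Hoelder bound on the derivative leave an error
  \<open>q * 2 * \<bar>d\<bar> powr q\<close>; the constant 4 is the case
  \<open>q = 2\<close>.\<close>

lemma abs_powr_expansion:
  fixes s d q :: real
  assumes "1 < q" "q \<le> 2"
  shows "\<bar>s + d\<bar> powr q \<le> \<bar>s\<bar> powr q + q * (sgn s * \<bar>s\<bar> powr (q - 1)) * d + 4 * \<bar>d\<bar> powr q"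
proof -
  let ?g = "\<lambda>x. sgn x * \<bar>x\<bar> powr (q - 1)"
  have "\<exists>z. \<bar>z - s\<bar> \<le> \<bar>d\<bar> \<and> \<bar>s + d\<bar> powr q - \<bar>s\<bar> powr q = d * (q * ?g z)"
  proof -
    consider "d > 0" | "d < 0" | "d = 0" by linarith
    then show ?thesis
    proof cases
      case 1
      then obtain z where "z > s" "z < s + d" "\<bar>s + d\<bar> powr q - \<bar>s\<bar> powr q = (s + d - s) * (q * ?g z)"
        using MVT2[of s "s + d" "\<lambda>x. \<bar>x\<bar> powr q" "\<lambda>x. q * ?g x"] has_real_derivative_abs_powr[OF assms(1)] by auto
      then show ?thesis by (intro exI[of _ z]) auto
    next
      case 2
      then obtain z where "z > s + d" "z < s" "\<bar>s\<bar> powr q - \<bar>s + d\<bar> powr q = (s - (s + d)) * (q * ?g z)"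
        using MVT2[of "s + d" s "\<lambda>x. \<bar>x\<bar> powr q" "\<lambda>x. q * ?g x"] has_real_derivative_abs_powr[OF assms(1)] by auto
      then show ?thesis by (intro exI[of _ z]) (auto simp: algebra_simps)
    qed auto
  qed
  then obtain z where z: "\<bar>z - s\<bar> \<le> \<bar>d\<bar>" "\<bar>s + d\<bar> powr q - \<bar>s\<bar> powr q = d * (q * ?g z)" by auto
  have "d * (?g z - ?g s) \<le> \<bar>d\<bar> * \<bar>?g z - ?g s\<bar>" by (metis abs_ge_self abs_mult)
  also have "\<dots> \<le> \<bar>d\<bar> * (2 * \<bar>d\<bar> powr (q - 1))"
  proof (rule mult_left_mono)
    have "\<bar>?g z - ?g s\<bar> \<le> 2 * \<bar>z - s\<bar> powr (q - 1)" using assms by (intro signed_powr_diff_le) auto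
    also have "\<dots> \<le> 2 * \<bar>d\<bar> powr (q - 1)" using assms z(1) by (intro mult_left_mono powr_mono2) auto
    finally show "\<bar>?g z - ?g s\<bar> \<le> 2 * \<bar>d\<bar> powr (q - 1)" .
  qed simp
  also have "\<dots> = 2 * \<bar>d\<bar> powr q" by (cases "d = 0") (auto simp: powr_diff)
  finally have "q * (d * (?g z - ?g s)) \<le> q * (2 * \<bar>d\<bar> powr q)" using assms by (intro mult_left_mono) auto
  also have "\<dots> \<le> 2 * (2 * \<bar>d\<bar> powr q)" using assms by (intro mult_right_mono) auto
  finally have "d * (q * ?g z) \<le> q * ?g s * d + 4 * \<bar>d\<bar> powr q" by (simp add: algebra_simps)
  then show ?thesis using z(2) by linarith
qed


section \<open>Deviations of the homogeneous chain\<close>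

text \<open>One increment of the martingale, started from the value \<open>y\<close>. Since
  \<open>\<rho> * (z + 1)\<close> is the mean of the urn law, the linear term of
  \<open>abs_powr_expansion\<close> integrates to 0.\<close>

lemma urn_abs_moment_step:
  fixes y a q :: real
  defines "\<rho> \<equiv> 1 / (a - 1)"
  assumes "a > 2" "1 < q" "q \<le> 2" "q < a - 1"
  shows "(\<integral>\<^sup>+k. ennreal (\<bar>y + (real k - \<rho> * (real z + 1))\<bar> powr q) \<partial>urn_pmf a 1 (Suc z)) \<le>
    ennreal (\<bar>y\<bar> powr q) + ennreal 4 * (\<integral>\<^sup>+k. ennreal ((real k + 1) powr q) \<partial>urn_pmf a 1 (Suc z))
      + ennreal 4 * ennreal ((real z + 1) powr q)"
proof -
  define u where "u = urn_pmf a 1 (Suc z)"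
  let ?D = "\<lambda>k. real k - \<rho> * (real z + 1)" and ?g = "q * (sgn y * \<bar>y\<bar> powr (q - 1))"
  let ?P = "\<lambda>k. (real k + 1) powr q"
  have \<rho>: "0 < \<rho>" "\<rho> < 1" using assms by (auto simp: \<rho>_def)
  have intP: "integrable u ?P"
    using urn_moment_finite[of q a z] assms unfolding u_def
    by (intro integrableI_nonneg) auto
  have int1: "integrable u (\<lambda>k. real k)"
  proof (rule Bochner_Integration.integrable_bound[OF intP])
    have "real k \<le> ?P k" for k
      using powr_mono[of 1 q "real k + 1"] assms by simp
    then show "AE k in u. norm (real k) \<le> norm (?P k)" by simp
  qed simp
  have nnP: "(\<integral>\<^sup>+k. ennreal (?P k) \<partial>u) = ennreal (measure_pmf.expectation u ?P)"
    using intP by (intro nn_integral_eq_integral) auto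
  have "ennreal (measure_pmf.expectation u real) = (\<integral>\<^sup>+k. ennreal (real k) \<partial>u)"
    using int1 by (intro nn_integral_eq_integral[symmetric]) auto
  also have "\<dots> = ennreal (\<rho> * (real z + 1))"
    using nn_integral_urn_id[of a 1 "Suc z"] assms unfolding u_def by (simp add: \<rho>_def add_ac)
  finally have mean: "measure_pmf.expectation u real = \<rho> * (real z + 1)"
    using \<rho> by (subst (asm) ennreal_inj) (auto intro: integral_nonneg_AE)
  let ?R = "\<lambda>k. \<bar>y\<bar> powr q + ?g * ?D k + 4 * (?P k + (real z + 1) powr q)"
  have le: "\<bar>y + ?D k\<bar> powr q \<le> ?R k" for k
  proof -
    \<comment> \<open>A difference of nonnegative numbers is at most their maximum, and
      \<open>\<rho> < 1\<close>.\<close>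
    have "\<bar>?D k\<bar> \<le> max (real k + 1) (real z + 1)"
      using \<rho> mult_right_mono[of \<rho> 1 "real z + 1"] mult_nonneg_nonneg[of \<rho> "real z + 1"]
      by (smt (verit) of_nat_0_le_iff)
    then have "\<bar>?D k\<bar> powr q \<le> max (real k + 1) (real z + 1) powr q"
      using assms by (intro powr_mono2) auto
    also have "\<dots> \<le> ?P k + (real z + 1) powr q" by (auto simp: max_def)
    finally show ?thesis using abs_powr_expansion[of q y "?D k"] assms by simp
  qed
  have nnR: "0 \<le> ?R k" for k by (rule order_trans[OF powr_ge_zero le])
  have intR: "integrable u ?R"
    using intP int1 by (intro Bochner_Integration.integrable_add integrable_mult_right
      Bochner_Integration.integrable_diff) auto
  have "(\<integral>\<^sup>+k. ennreal (\<bar>y + ?D k\<bar> powr q) \<partial>u) \<le> (\<integral>\<^sup>+k. ennreal (?R k) \<partial>u)"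
    by (intro nn_integral_mono ennreal_leI le)
  also have "\<dots> = ennreal (measure_pmf.expectation u ?R)"
    by (rule nn_integral_eq_integral[OF intR]) (rule AE_I2, rule nnR)
  also have "measure_pmf.expectation u ?R = \<bar>y\<bar> powr q + 4 * (measure_pmf.expectation u ?P + (real z + 1) powr q)"
    using intP int1 by (simp add: mean)
  also have "ennreal \<dots> = ennreal (\<bar>y\<bar> powr q) + ennreal 4 * ennreal (measure_pmf.expectation u ?P)
      + ennreal 4 * ennreal ((real z + 1) powr q)"
  proof -
    have "measure_pmf.expectation u ?P \<ge> 0" by (rule integral_nonneg_AE) simp
    moreover from this have "ennreal 4 * ennreal (measure_pmf.expectation u ?P) = ennreal (4 * measure_pmf.expectation u ?P)"
      by (intro ennreal_mult[symmetric]) auto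
    moreover have "ennreal 4 * ennreal ((real z + 1) powr q) = ennreal (4 * (real z + 1) powr q)"
      by (intro ennreal_mult[symmetric]) auto
    ultimately show ?thesis by (simp add: distrib_left add.assoc)
  qed
  finally show ?thesis unfolding u_def[symmetric] nnP .
qed

text \<open>\<open>(1 - \<rho>) * s + \<rho> * z - \<rho> * n\<close> is a martingale; its \<open>q\<close>-th absolute moment grows linearly, as in
  the inequality of von Bahr and Esseen.\<close>

lemma hom_chain_martingale_moment:
  fixes a q :: real
  defines "\<rho> \<equiv> 1 / (a - 1)"
  assumes "a > 2" "1 < q" "q \<le> 2" "q < a - 1"
  shows "(\<integral>\<^sup>+sz. ennreal (\<bar>(1 - \<rho>) * real (fst sz) + \<rho> * real (snd sz) - \<rho> * real n\<bar> powr q) \<partial>hom_chain a 1 n (0, 0))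
    \<le> ennreal (8 * real n * moment_bound a q)"
proof (induction n)
  case (Suc n)
  let ?Y = "\<lambda>sz n. (1 - \<rho>) * real (fst sz) + \<rho> * real (snd sz) - \<rho> * real n"
  let ?P = "\<lambda>k. ennreal ((real k + 1) powr q)"
  let ?W = "moment_bound a q"
  let ?h = "hom_chain a 1 n (0, 0)"
  have W: "?W \<ge> 0" using assms by (intro moment_bound_nonneg) auto
  have site: "(\<integral>\<^sup>+sz. f (snd sz) \<partial>hom_chain a 1 n (0, 0)) = (\<integral>\<^sup>+z. f z \<partial>site_law a n)" for f n
    by (simp add: site_law_def)
  have "(\<integral>\<^sup>+sz. ennreal (\<bar>?Y sz (Suc n)\<bar> powr q) \<partial>hom_chain a 1 (Suc n) (0, 0)) =
     (\<integral>\<^sup>+sz. \<integral>\<^sup>+k. ennreal (\<bar>?Y (fst sz + k, k) (Suc n)\<bar> powr q) \<partial>urn_pmf a 1 (Suc (snd sz)) \<partial>?h)"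
    unfolding hom_chain_Suc' by (simp del: urn_pmf.simps)
  \<comment> \<open>Both \<open>s\<close> and \<open>z\<close> change with \<open>k\<close>, and the
    coefficients \<open>1 - \<rho>\<close> and \<open>\<rho>\<close> are chosen so that
    \<open>k\<close> enters with coefficient 1 and \<open>s\<close> keeps its own.\<close>
  also have "\<dots> = (\<integral>\<^sup>+sz. \<integral>\<^sup>+k. ennreal (\<bar>?Y sz n + (real k - \<rho> * (real (snd sz) + 1))\<bar> powr q) \<partial>urn_pmf a 1 (Suc (snd sz)) \<partial>?h)"
    by (simp add: algebra_simps del: urn_pmf.simps)
  also have "\<dots> \<le> (\<integral>\<^sup>+sz. ennreal (\<bar>?Y sz n\<bar> powr q) + ennreal 4 * (\<integral>\<^sup>+k. ?P k \<partial>urn_pmf a 1 (Suc (snd sz)))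
      + ennreal 4 * ?P (snd sz) \<partial>?h)"
    unfolding \<rho>_def using assms by (intro nn_integral_mono urn_abs_moment_step) auto
  also have "\<dots> = (\<integral>\<^sup>+sz. ennreal (\<bar>?Y sz n\<bar> powr q) \<partial>?h) + ennreal 4 * (\<integral>\<^sup>+z. ?P z \<partial>site_law a (Suc n))
      + ennreal 4 * (\<integral>\<^sup>+z. ?P z \<partial>site_law a n)"
    unfolding site_law_Suc nn_integral_bind_pmf site[symmetric]
    by (simp add: nn_integral_add nn_integral_cmult del: urn_pmf.simps)
  \<comment> \<open>The two terms with factor 4 are moments of consecutive sites, both bounded by
    \<open>?W\<close>; this is the 8 per step.\<close>
  also have "\<dots> \<le> ennreal (8 * real n * ?W) + ennreal 4 * ennreal ?W + ennreal 4 * ennreal ?W"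
    using assms by (intro add_mono mult_left_mono Suc.IH moment_site_law_le) auto
  also have "\<dots> = ennreal (8 * real (Suc n) * ?W)"
  proof -
    have "ennreal 4 * ennreal ?W = ennreal (4 * ?W)" using W by (intro ennreal_mult[symmetric]) auto
    moreover have "ennreal (8 * real n * ?W) + ennreal (4 * ?W) + ennreal (4 * ?W)
        = ennreal (8 * real n * ?W + 4 * ?W + 4 * ?W)"
      using W by (simp del: ennreal_plus flip: ennreal_plus)
    ultimately show ?thesis by (simp add: algebra_simps del: ennreal_plus)
  qed
  finally show ?case .
qed simp

lemma markov_pmf:
  fixes f :: "'b \<Rightarrow> real"
  assumes "(\<integral>\<^sup>+x. ennreal (f x) \<partial>measure_pmf p) \<le> ennreal m" "t > 0" "m \<ge> 0"
  shows "measure_pmf.prob p {x. t \<le> f x} \<le> m / t"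
proof -
  have "{x. t \<le> f x} \<subseteq> {x \<in> UNIV. 1 \<le> ennreal (1 / t) * ennreal (f x)}"
  proof safe
    fix x assume *: "t \<le> f x"
    then have "1 \<le> 1 / t * f x" using assms by (simp add: field_simps)
    then have "ennreal 1 \<le> ennreal (1 / t * f x)" by (rule ennreal_leI)
    then show "1 \<le> ennreal (1 / t) * ennreal (f x)" using * assms by (simp flip: ennreal_mult)
  qed simp
  then have "emeasure p {x. t \<le> f x} \<le> emeasure p {x \<in> UNIV. 1 \<le> ennreal (1 / t) * ennreal (f x)}"
    by (intro emeasure_mono) auto
  also have "\<dots> \<le> ennreal (1 / t) * (\<integral>\<^sup>+x. ennreal (f x) * indicator UNIV x \<partial>measure_pmf p)"
    by (intro nn_integral_Markov_inequality) auto
  also have "\<dots> \<le> ennreal (1 / t) * ennreal m"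
    using assms by (intro mult_left_mono) auto
  also have "\<dots> = ennreal (m / t)" using assms by (simp flip: ennreal_mult)
  finally show ?thesis using assms
    by (simp add: measure_pmf.emeasure_eq_measure)
qed

lemma markov_powr:
  fixes f :: "'b \<Rightarrow> real"
  assumes "(\<integral>\<^sup>+x. ennreal (f x powr q) \<partial>measure_pmf p) \<le> ennreal m" "t > 0" "q > 0" "m \<ge> 0"
  shows "measure_pmf.prob p {x. t \<le> f x} \<le> m / t powr q"
proof -
  have "measure_pmf.prob p {x. t \<le> f x} \<le> measure_pmf.prob p {x. t powr q \<le> f x powr q}"
    using assms by (intro measure_pmf.finite_measure_mono) (auto intro!: powr_mono2)
  also have "\<dots> \<le> m / t powr q" using assms by (intro markov_pmf) auto
  finally show ?thesis .
qed

text \<open>The martingale is small compared with \<open>n\<close>, and so is \<open>z\<close>,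
  which forces \<open>s\<close> close to \<open>\<rho> * n / (1 - \<rho>) = n / (a - 2)\<close>. The
  form \<open>n + 1\<close> fits the level \<open>N = n + 1\<close>, below which there are
  \<open>n\<close> positive sites.\<close>

lemma hom_chain_deviation:
  fixes a :: real
  assumes "a > 2"
  shows "\<exists>q>1. \<forall>\<epsilon>>0. \<exists>C\<ge>0. \<forall>n. measure_pmf.prob (hom_chain a 1 n (0, 0))
    {sz. \<epsilon> * (real n + 1) \<le> \<bar>real (fst sz) - (real n + 1) / (a - 2)\<bar>} \<le> C * (real n + 1) powr (1 - q)"
proof -
  \<comment> \<open>From \<open>a > 2\<close> follows \<open>1 < a / 2 < a - 1\<close>; the cap 2 is
    for the Taylor estimate.\<close>
  define q where "q = min 2 (a / 2)"
  have q: "1 < q" "q \<le> 2" "q < a - 1" using assms by (auto simp: q_def min_def)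
  define \<rho> where "\<rho> = 1 / (a - 1)"
  have \<rho>: "0 < \<rho>" "\<rho> < 1" using assms by (auto simp: \<rho>_def)
  define W where "W = moment_bound a q"
  have W: "W \<ge> 0" unfolding W_def using q by (intro moment_bound_nonneg) auto
  have "\<exists>C\<ge>0. \<forall>n. measure_pmf.prob (hom_chain a 1 n (0, 0))
    {sz. \<epsilon> * (real n + 1) \<le> \<bar>real (fst sz) - (real n + 1) / (a - 2)\<bar>} \<le> C * (real n + 1) powr (1 - q)"
    if \<epsilon>: "\<epsilon> > 0" for \<epsilon>
  proof -
    \<comment> \<open>One half is granted to the martingale, the other to the last site.\<close>
    define \<delta> where "\<delta> = \<epsilon> * (1 - \<rho>) / 2"
    have \<delta>: "\<delta> > 0" using \<epsilon> \<rho> by (simp add: \<delta>_def)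
    define C where "C = 8 * W / \<delta> powr q"
    show ?thesis
    proof (intro exI[of _ C] conjI allI)
      show "C \<ge> 0" using W by (simp add: C_def)
      fix n
      let ?h = "hom_chain a 1 n (0, 0)" and ?t = "\<delta> * (real n + 1)"
      let ?Y = "\<lambda>sz. (1 - \<rho>) * real (fst sz) + \<rho> * real (snd sz) - \<rho> * real n"
      have t: "?t > 0" using \<delta> by simp
      have "measure_pmf.prob ?h {sz. \<epsilon> * (real n + 1) \<le> \<bar>real (fst sz) - (real n + 1) / (a - 2)\<bar>}
        \<le> measure_pmf.prob ?h ({sz. ?t \<le> \<bar>?Y sz\<bar>} \<union> {sz. ?t \<le> real (snd sz) + 1})"
      proof (intro measure_pmf.finite_measure_mono subsetI)
        fix sz :: "nat \<times> nat" assume "sz \<in> {sz. \<epsilon> * (real n + 1) \<le> \<bar>real (fst sz) - (real n + 1) / (a - 2)\<bar>}"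
        then have "(1 - \<rho>) * (\<epsilon> * (real n + 1)) \<le> (1 - \<rho>) * \<bar>real (fst sz) - (real n + 1) / (a - 2)\<bar>"
          using \<rho> by (intro mult_left_mono) auto
        also have "\<dots> = \<bar>(1 - \<rho>) * (real (fst sz) - (real n + 1) / (a - 2))\<bar>"
          using \<rho> by (simp add: abs_mult)
        also have "(1 - \<rho>) * (real (fst sz) - (real n + 1) / (a - 2)) = ?Y sz - \<rho> * (real (snd sz) + 1)"
        proof -
          have "1 - \<rho> = (a - 2) / (a - 1)" using assms by (simp add: \<rho>_def field_simps)
          then have "(1 - \<rho>) / (a - 2) = \<rho>" using assms by (simp add: \<rho>_def)
          then have "(1 - \<rho>) * ((real n + 1) / (a - 2)) = \<rho> * (real n + 1)"
            by (metis times_divide_eq_left times_divide_eq_right)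
          then show ?thesis by (simp add: right_diff_distrib) (simp add: algebra_simps)
        qed
        also have "\<bar>?Y sz - \<rho> * (real (snd sz) + 1)\<bar> \<le> \<bar>?Y sz\<bar> + \<rho> * (real (snd sz) + 1)"
          using \<rho> abs_triangle_ineq4[of "?Y sz" "\<rho> * (real (snd sz) + 1)"] by (simp add: abs_mult)
        also have "\<dots> \<le> \<bar>?Y sz\<bar> + (real (snd sz) + 1)"
          using \<rho> mult_right_mono[of \<rho> 1 "real (snd sz) + 1"] by simp
        also have "(1 - \<rho>) * (\<epsilon> * (real n + 1)) = 2 * ?t" by (simp add: \<delta>_def)
        finally have "2 * ?t \<le> \<bar>?Y sz\<bar> + (real (snd sz) + 1)" .
        then show "sz \<in> {sz. ?t \<le> \<bar>?Y sz\<bar>} \<union> {sz. ?t \<le> real (snd sz) + 1}" by auto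
      qed auto
      also have "\<dots> \<le> measure_pmf.prob ?h {sz. ?t \<le> \<bar>?Y sz\<bar>} + measure_pmf.prob ?h {sz. ?t \<le> real (snd sz) + 1}"
        by (rule measure_Un_le) auto
      also have "\<dots> \<le> 8 * real n * W / ?t powr q + W / ?t powr q"
      proof (intro add_mono markov_powr t)
        show "(\<integral>\<^sup>+x. ennreal (\<bar>?Y x\<bar> powr q) \<partial>?h) \<le> ennreal (8 * real n * W)"
          unfolding W_def \<rho>_def using assms q by (intro hom_chain_martingale_moment) auto
        show "(\<integral>\<^sup>+x. ennreal ((real (snd x) + 1) powr q) \<partial>?h) \<le> ennreal W"
          using moment_site_law_le[of q a n] q by (simp add: site_law_def W_def)
      qed (use q W in auto)
      also have "\<dots> = (8 * real n + 1) * W / ?t powr q" by (simp add: add_divide_distrib distrib_right)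
      also have "\<dots> \<le> 8 * (real n + 1) * W / ?t powr q"
        using W by (intro divide_right_mono mult_right_mono) auto
      also have "\<dots> = C * (real n + 1) powr (1 - q)"
        using \<delta> by (simp add: C_def powr_mult powr_diff mult_ac)
      finally show "measure_pmf.prob ?h {sz. \<epsilon> * (real n + 1) \<le> \<bar>real (fst sz) - (real n + 1) / (a - 2)\<bar>}
          \<le> C * (real n + 1) powr (1 - q)" .
    qed
  qed
  then show ?thesis using q by auto
qed


section \<open>From hitting times to the speed\<close>

text \<open>Rounding changes the root, which tends to infinity, by at most 1, hence by a factor
  tending to 1, and so it does for the fixed power \<open>m\<close>.\<close>

lemma power_index_ratio:
  fixes g :: real and i :: "nat \<Rightarrow> nat"
  assumes "g > 0" "m \<ge> 1" "\<And>n. \<bar>real (i n) - root m (real n / g)\<bar> \<le> 1"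
  shows "(\<lambda>n. real (i n ^ m) / real n) \<longlonglongrightarrow> 1 / g"
proof -
  define u where "u n = root m (real n / g)" for n
  have u: "u n > 0" "u n ^ m = real n / g" if "n > 0" for n
    using assms that by (auto simp: u_def)
  have lim: "filterlim u at_top sequentially"
  proof (rule filterlim_at_top_mono[OF _ always_eventually], rule filterlim_compose[OF _ filterlim_real_sequentially])
    show "filterlim (\<lambda>x. root m (x / g)) at_top at_top"
    proof (rule filterlim_at_top_at_top[where Q = "\<lambda>_. True" and P = "\<lambda>x. x \<ge> 0" and g = "\<lambda>x. g * x ^ m"])
      fix x :: real assume "x \<ge> 0"
      then show "root m (g * x ^ m / g) = x" using assms by (simp add: real_root_power_cancel)
    qed (use assms in \<open>auto intro!: eventually_ge_at_top divide_right_mono\<close>)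
  qed (auto simp: u_def)
  have "(\<lambda>n. inverse (u n)) \<longlonglongrightarrow> 0"
    by (rule tendsto_inverse_0_at_top[OF lim])
  then have "(\<lambda>n. real (i n) / u n - 1) \<longlonglongrightarrow> 0"
  proof (rule Lim_null_comparison[rotated])
    show "\<forall>\<^sub>F n in sequentially. norm (real (i n) / u n - 1) \<le> inverse (u n)"
      using eventually_gt_at_top[of 0]
    proof eventually_elim
      case (elim n)
      have "real (i n) / u n - 1 = (real (i n) - u n) / u n" using u(1)[OF elim] by (simp add: field_simps)
      then show ?case using assms(3)[of n] u(1)[OF elim] by (simp add: u_def abs_divide divide_simps)
    qed
  qed
  then have "(\<lambda>n. real (i n) / u n) \<longlonglongrightarrow> 1" by (rule LIM_zero_cancel)
  then have "(\<lambda>n. (real (i n) / u n) ^ m / g) \<longlonglongrightarrow> 1 ^ m / g"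
    using assms by (intro tendsto_intros) auto
  then have "(\<lambda>n. (real (i n) / u n) ^ m / g) \<longlonglongrightarrow> 1 / g" by simp
  then show ?thesis
  proof (rule Lim_transform_eventually)
    show "\<forall>\<^sub>F n in sequentially. (real (i n) / u n) ^ m / g = real (i n ^ m) / real n"
      using eventually_gt_at_top[of 0]
      by eventually_elim (use assms u in \<open>simp add: power_divide\<close>)
  qed
qed

lemma root_index_at_top:
  fixes g :: real
  assumes "g > 0" "m \<ge> 1"
  shows "filterlim (\<lambda>n. nat \<lfloor>root m (real n / g)\<rfloor>) at_top sequentially"
    and "filterlim (\<lambda>n. nat \<lceil>root m (real n / g)\<rceil>) at_top sequentially"
proof -
  have *: "filterlim (\<lambda>n. nat \<lfloor>root m (real n / g)\<rfloor>) at_top sequentially"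
    unfolding filterlim_at_top
  proof (intro allI)
    fix Z
    show "\<forall>\<^sub>F n in sequentially. Z \<le> nat \<lfloor>root m (real n / g)\<rfloor>"
      using eventually_ge_at_top[of "nat \<lceil>g * real Z ^ m\<rceil>"]
    proof eventually_elim
      case (elim n)
      then have "g * real Z ^ m \<le> real n" by linarith
      then have "real Z ^ m \<le> real n / g" using assms by (simp add: field_simps)
      then have "root m (real Z ^ m) \<le> root m (real n / g)" using assms by simp
      then have "real Z \<le> root m (real n / g)" using assms by (simp add: real_root_power_cancel)
      then show ?case by linarith
    qed
  qed
  show "filterlim (\<lambda>n. nat \<lfloor>root m (real n / g)\<rfloor>) at_top sequentially" by fact
  show "filterlim (\<lambda>n. nat \<lceil>root m (real n / g)\<rceil>) at_top sequentially"
    by (rule filterlim_at_top_mono[OF *]) (auto intro!: always_eventually nat_mono simp: floor_le_ceiling)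
qed

section \<open>Bounds on a single path from its hitting times\<close>

lemma below_if_not_hit:
  fixes x :: "nat \<Rightarrow> int"
  assumes "x 0 = 0" "\<And>n. \<bar>x (Suc n) - x n\<bar> \<le> 1" "N > 0" "\<And>j. j \<le> t \<Longrightarrow> x j \<noteq> N"
  shows "x t < N"
  using assms(4)
proof (induction t)
  case 0
  then show ?case using assms by simp
next
  case (Suc t)
  then show ?case using assms(2)[of t] Suc.prems[of "Suc t"] Suc.IH by fastforce
qed

text \<open>With the root rounded up, \<open>n \<le> g * i n ^ m\<close>, so the level
  \<open>i n ^ m\<close> has not been hit by time \<open>n\<close> and the path is below it; this
  level is asymptotic to \<open>n / g\<close>.\<close>

lemma speed_upper:
  fixes x :: "nat \<Rightarrow> int" and g :: real
  assumes x: "x 0 = 0" "\<And>n. \<bar>x (Suc n) - x n\<bar> \<le> 1" and "g > 0" "m \<ge> 1" "\<delta> > 0"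
    and "\<forall>\<^sub>F i in sequentially. \<forall>j\<le>nat \<lfloor>g * real (i ^ m)\<rfloor>. x j \<noteq> int (i ^ m)"
  shows "\<forall>\<^sub>F n in sequentially. real_of_int (x n) / real n \<le> 1 / g + \<delta>"
proof -
  define i where "i n = nat \<lceil>root m (real n / g)\<rceil>" for n
  have r0: "root m (real n / g) \<ge> 0" for n using assms by simp
  have "(\<lambda>n. real (i n ^ m) / real n) \<longlonglongrightarrow> 1 / g"
    using assms r0 unfolding i_def by (intro power_index_ratio) (auto simp: abs_le_iff, linarith+)
  then have "\<forall>\<^sub>F n in sequentially. real (i n ^ m) / real n < 1 / g + \<delta>"
    using assms by (intro order_tendstoD(2)) auto
  moreover have "\<forall>\<^sub>F n in sequentially. \<forall>j\<le>nat \<lfloor>g * real (i n ^ m)\<rfloor>. x j \<noteq> int (i n ^ m)"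
    using root_index_at_top(2)[OF assms(3,4)] assms(6) unfolding i_def[symmetric] filterlim_iff by blast
  ultimately show ?thesis using eventually_gt_at_top[of 0]
  proof eventually_elim
    case (elim n)
    have "root m (real n / g) \<le> real (i n)" unfolding i_def by linarith
    then have "root m (real n / g) ^ m \<le> real (i n) ^ m" using r0 by (rule power_mono)
    then have "real n / g \<le> real (i n ^ m)" using assms by simp
    then have n: "real n \<le> g * real (i n ^ m)" using assms by (simp add: field_simps)
    then have "n \<le> nat \<lfloor>g * real (i n ^ m)\<rfloor>" by linarith
    moreover have "int (i n ^ m) > 0"
    proof -
      have "real (i n ^ m) > 0" using n elim(3) assms(3) by (metis gr0I linorder_not_less mult_zero_right of_nat_0 of_nat_0_less_iff)
      then show ?thesis by simp
    qed
    ultimately have "x n < int (i n ^ m)" using elim(2) by (intro below_if_not_hit[OF x]) auto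
    then have "real_of_int (x n) \<le> real (i n ^ m)" by linarith
    then have "real_of_int (x n) / real n \<le> real (i n ^ m) / real n" by (intro divide_right_mono) auto
    then show ?case using elim(1) by simp
  qed
qed

lemma nn_dist:
  fixes x :: "nat \<Rightarrow> int"
  assumes "\<And>n. \<bar>x (Suc n) - x n\<bar> \<le> 1" "j \<le> n"
  shows "x n \<ge> x j - int (n - j)"
  using assms(2)
proof (induction n rule: dec_induct)
  case (step n)
  then show ?case using assms(1)[of n] by linarith
qed simp

text \<open>After hitting \<open>N = i ^ m\<close> at a time larger than \<open>g' * N\<close>, the walk cannot be below
  \<open>N - (n - g' * N)\<close> at time \<open>n\<close>, and \<open>n\<close> is close to \<open>g * N\<close>.\<close>

lemma speed_lower:
  fixes x :: "nat \<Rightarrow> int" and g g' :: real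
  assumes x: "\<And>n. \<bar>x (Suc n) - x n\<bar> \<le> 1" and "0 < g'" "g > 0" "m \<ge> 1" "\<delta> > 0"
    and "\<forall>\<^sub>F i in sequentially. \<forall>j\<le>nat \<lfloor>g' * real (i ^ m)\<rfloor>. x j \<noteq> int (i ^ m)"
    and "\<forall>\<^sub>F i in sequentially. \<exists>j\<le>nat \<lfloor>g * real (i ^ m)\<rfloor>. x j = int (i ^ m)"
  shows "\<forall>\<^sub>F n in sequentially. real_of_int (x n) / real n \<ge> (1 + g') / g - 1 - \<delta>"
proof -
  define i where "i n = nat \<lfloor>root m (real n / g)\<rfloor>" for n
  have r0: "root m (real n / g) \<ge> 0" for n using assms by simp
  have "(\<lambda>n. real (i n ^ m) / real n) \<longlonglongrightarrow> 1 / g"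
    using assms r0 unfolding i_def by (intro power_index_ratio) (auto simp: abs_le_iff, linarith+)
  then have "(\<lambda>n. (1 + g') * (real (i n ^ m) / real n) - 1) \<longlonglongrightarrow> (1 + g') * (1 / g) - 1"
    by (rule tendsto_diff[OF tendsto_mult[OF tendsto_const] tendsto_const])
  then have "\<forall>\<^sub>F n in sequentially. (1 + g') * (real (i n ^ m) / real n) - 1 > (1 + g') / g - 1 - \<delta>"
    using assms by (intro order_tendstoD(1)) auto
  moreover have "\<forall>\<^sub>F n in sequentially. \<forall>j\<le>nat \<lfloor>g' * real (i n ^ m)\<rfloor>. x j \<noteq> int (i n ^ m)"
    using root_index_at_top(1)[OF assms(3,4)] assms(6) unfolding i_def[symmetric] filterlim_iff by blast
  moreover have "\<forall>\<^sub>F n in sequentially. \<exists>j\<le>nat \<lfloor>g * real (i n ^ m)\<rfloor>. x j = int (i n ^ m)"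
    using root_index_at_top(1)[OF assms(3,4)] assms(7) unfolding i_def[symmetric] filterlim_iff by blast
  ultimately show ?thesis using eventually_gt_at_top[of 0]
  proof eventually_elim
    case (elim n)
    have "real (i n) \<le> root m (real n / g)" using r0[of n] unfolding i_def by linarith
    then have "real (i n) ^ m \<le> root m (real n / g) ^ m" by (rule power_mono) simp
    then have "real (i n ^ m) \<le> real n / g" using assms by simp
    then have n: "g * real (i n ^ m) \<le> real n" using assms by (simp add: field_simps)
    obtain j where j: "j \<le> nat \<lfloor>g * real (i n ^ m)\<rfloor>" "x j = int (i n ^ m)" using elim(3) by auto
    have "0 \<le> g * real (i n ^ m)" using assms by (intro mult_nonneg_nonneg) auto
    then have "real j \<le> g * real (i n ^ m)" using j(1) by linarith
    then have jn: "j \<le> n" using n by linarith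
    have "\<not> j \<le> nat \<lfloor>g' * real (i n ^ m)\<rfloor>" using elim(2) j(2) by auto
    then have "real j > g' * real (i n ^ m)" by linarith
    moreover have "x n \<ge> x j - int (n - j)" using nn_dist[of x, OF x jn] .
    then have "real_of_int (int (i n ^ m) - int (n - j)) \<le> real_of_int (x n)"
      unfolding j(2) by (simp only: of_int_le_iff)
    then have "real_of_int (x n) \<ge> real (i n ^ m) - (real n - real j)"
      using jn by (simp add: of_nat_diff)
    ultimately have "real_of_int (x n) \<ge> (1 + g') * real (i n ^ m) - real n" by (simp add: distrib_right)
    then have "real_of_int (x n) / real n \<ge> ((1 + g') * real (i n ^ m) - real n) / real n"
      by (intro divide_right_mono) auto
    also have "((1 + g') * real (i n ^ m) - real n) / real n = (1 + g') * (real (i n ^ m) / real n) - 1"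
      using elim(4) by (simp add: diff_divide_distrib)
    finally show ?case using elim(1) by simp
  qed
qed

lemma tendsto_squeeze_eventually:
  fixes f :: "nat \<Rightarrow> real"
  assumes "U \<longlonglongrightarrow> v" "L \<longlonglongrightarrow> v"
    and U: "\<And>k \<delta>. \<delta> > 0 \<Longrightarrow> \<forall>\<^sub>F n in sequentially. f n \<le> U k + \<delta>"
    and L: "\<And>k \<delta>. \<delta> > 0 \<Longrightarrow> \<forall>\<^sub>F n in sequentially. f n \<ge> L k - \<delta>"
  shows "f \<longlonglongrightarrow> v"
proof (rule order_tendstoI)
  fix w assume "w < v"
  then have "\<forall>\<^sub>F k in sequentially. L k > (v + w) / 2" using assms(2) by (intro order_tendstoD(1)) auto
  then obtain k where k: "L k > (v + w) / 2" by (auto simp: eventually_sequentially)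
  show "\<forall>\<^sub>F n in sequentially. w < f n"
    using L[of "(v - w) / 2" k] \<open>w < v\<close> k by (auto elim!: eventually_mono simp: field_simps)
next
  fix w assume "w > v"
  then have "\<forall>\<^sub>F k in sequentially. U k < (v + w) / 2" using assms(1) by (intro order_tendstoD(2)) auto
  then obtain k where k: "U k < (v + w) / 2" by (auto simp: eventually_sequentially)
  show "\<forall>\<^sub>F n in sequentially. f n < w"
    using U[of "(w - v) / 2" k] \<open>w > v\<close> k by (auto elim!: eventually_mono simp: field_simps)
qed


section \<open>Almost sure hitting times\<close>

lemma chain_append:
  "chain al be l r (i + j) x sz = bind_pmf (chain al be l r i x sz) (chain al be l r j (x - int i))"
proof (induction i arbitrary: x sz)
  case (Suc i)
  have "x - 1 - int i = x - int (Suc i)" by simp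
  then show ?case by (simp only: add_Suc chain.simps Suc.IH bind_assoc_pmf)
qed (simp add: bind_return_pmf)

lemma chain_eq_hom_chain:
  assumes "\<And>x. x > 0 \<Longrightarrow> al x = A \<and> be x = B" "x \<ge> int j"
  shows "chain al be (\<lambda>_. 0) (\<lambda>_. 0) j x sz = hom_chain A B j sz"
  using assms(2)
proof (induction j arbitrary: x sz)
  case (Suc j)
  have "chain al be (\<lambda>_. 0) (\<lambda>_. 0) j (x - 1) sz = hom_chain A B j sz" for sz
    using Suc.prems by (intro Suc.IH) auto
  then show ?case using assms(1)[of x] Suc.prems by (simp del: urn_pmf.simps)
qed simp

text \<open>On the sites \<open>\<le> 0\<close> each urn at least halves the mean number of left
  steps, and below 0 there is no immigrant. The halves sum to at most the initial number, for every
  \<open>j\<close>. The offset \<open>c\<close> lets the bound be used for the left steps added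
  after a given state.\<close>

lemma chain_left_mean:
  assumes "\<And>x. x \<le> 0 \<Longrightarrow> al x > 1 \<and> be x > 0 \<and> be x / (al x - 1) \<le> 1 / 2"
    and "x \<le> 0" "c \<le> real (fst sz)"
  shows "(\<integral>\<^sup>+sz'. ennreal (real (fst sz') - c) \<partial>chain al be (\<lambda>_. 0) (\<lambda>_. 0) j x sz)
     \<le> ennreal (real (fst sz) - c + real (snd sz) + of_bool (0 \<le> x))"
  using assms(2,3)
proof (induction j arbitrary: x sz)
  case 0
  then show ?case by (auto intro!: ennreal_leI)
next
  case (Suc j)
  let ?d = "snd sz + of_bool (0 \<le> x)"
  let ?u = "urn_pmf (al x) (be x) ?d"
  have al: "al x > 1" "be x > 0" "be x / (al x - 1) \<le> 1 / 2" using assms(1)[OF Suc.prems(1)] by auto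
  have "(\<integral>\<^sup>+sz'. ennreal (real (fst sz') - c) \<partial>chain al be (\<lambda>_. 0) (\<lambda>_. 0) (Suc j) x sz) =
     (\<integral>\<^sup>+k. (\<integral>\<^sup>+sz'. ennreal (real (fst sz') - c) \<partial>chain al be (\<lambda>_. 0) (\<lambda>_. 0) j (x - 1) (fst sz + k, k)) \<partial>?u)"
    by simp
  also have "\<dots> \<le> (\<integral>\<^sup>+k. ennreal (real (fst sz + k) - c + real k) \<partial>?u)"
  proof (rule nn_integral_mono)
    fix k
    show "(\<integral>\<^sup>+sz'. ennreal (real (fst sz') - c) \<partial>chain al be (\<lambda>_. 0) (\<lambda>_. 0) j (x - 1) (fst sz + k, k))
        \<le> ennreal (real (fst sz + k) - c + real k)"
      using Suc.IH[of "x - 1" "(fst sz + k, k)"] Suc.prems by simp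
  qed
  also have "\<dots> = (\<integral>\<^sup>+k. ennreal (real (fst sz) - c) + ennreal 2 * ennreal (real k) \<partial>?u)"
  proof (rule nn_integral_cong)
    fix k
    have "ennreal 2 * ennreal (real k) = ennreal (2 * real k)" by (rule ennreal_mult[symmetric]) auto
    then show "ennreal (real (fst sz + k) - c + real k) = ennreal (real (fst sz) - c) + ennreal 2 * ennreal (real k)"
      using Suc.prems(2) by (simp add: algebra_simps flip: ennreal_plus)
  qed
  also have "\<dots> = ennreal (real (fst sz) - c) + ennreal 2 * ennreal (be x * real ?d / (al x - 1))"
    using al by (simp add: nn_integral_add nn_integral_cmult nn_integral_urn_id)
  also have "\<dots> = ennreal (real (fst sz) - c) + ennreal (2 * (be x * real ?d / (al x - 1)))"
    using al by (subst ennreal_mult[symmetric]) auto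
  also have "\<dots> = ennreal (real (fst sz) - c + 2 * (be x * real ?d / (al x - 1)))"
    using al Suc.prems by (intro ennreal_plus[symmetric]) auto
  also have "\<dots> \<le> ennreal (real (fst sz) - c + real ?d)"
  proof (rule ennreal_leI)
    have "be x / (al x - 1) * real ?d \<le> 1 / 2 * real ?d" by (rule mult_right_mono[OF al(3)]) simp
    moreover have "be x * real ?d / (al x - 1) = be x / (al x - 1) * real ?d" by (rule times_divide_eq_left[symmetric])
    moreover have "s + 2 * u \<le> s + d" if "p \<le> 1 / 2 * d" "u = p" for s u p d :: real using that by simp
    ultimately show "real (fst sz) - c + 2 * (be x * real ?d / (al x - 1)) \<le> real (fst sz) - c + real ?d" by blast
  qed
  finally show ?case by (simp add: add.assoc)
qed

lemma summable_power_powr: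
  assumes "real m * e \<ge> 2" "m \<ge> 1"
  shows "summable (\<lambda>i. real (i ^ m) powr - e)"
proof (rule summable_comparison_test_ev)
  show "summable (\<lambda>i. real i powr - 2)" by (simp add: summable_real_powr_iff)
  show "\<forall>\<^sub>F i in sequentially. norm (real (i ^ m) powr - e) \<le> real i powr - 2"
    using eventually_ge_at_top[of 1]
  proof eventually_elim
    case (elim i)
    have "real (i ^ m) powr - e = real i powr - (real m * e)"
      using elim by (simp add: powr_realpow[symmetric] powr_powr)
    also have "\<dots> \<le> real i powr - 2" using elim assms by (intro powr_mono) auto
    finally show ?case by simp
  qed
qed

context urn_walk
begin

lemma AE_unit_steps: "AE \<omega> in M. X 0 \<omega> = 0 \<and> (\<forall>n. \<bar>X (Suc n) \<omega> - X n \<omega>\<bar> \<le> 1)"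
  using start nearest_neighbour
proof eventually_elim
  case (elim \<omega>)
  show ?case
  proof (intro conjI allI)
    show "\<bar>X (Suc n) \<omega> - X n \<omega>\<bar> \<le> 1" for n using elim(2)[rule_format, of n] by auto
  qed fact
qed

lemma borel_cantelli_powers:
  assumes [measurable]: "\<And>i. E i \<in> events"
    and "\<And>i. i \<ge> 1 \<Longrightarrow> prob (E i) \<le> C * real (i ^ m) powr - e" "C \<ge> 0" "real m * e \<ge> 2" "m \<ge> 1"
  shows "AE \<omega> in M. \<forall>\<^sub>F i in sequentially. \<omega> \<notin> E i"
proof -
  have "summable (\<lambda>i. prob (E i))"
  proof (rule summable_comparison_test_ev)
    show "summable (\<lambda>i. C * real (i ^ m) powr - e)"
      by (intro summable_mult summable_power_powr assms)
    show "\<forall>\<^sub>F i in sequentially. norm (prob (E i)) \<le> C * real (i ^ m) powr - e"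
      using assms(2) by (intro eventually_sequentiallyI[of 1]) auto
  qed
  then have "AE \<omega> in M. \<forall>\<^sub>F i in sequentially. \<omega> \<in> space M - E i"
    by (intro borel_cantelli_AE1) (auto simp: emeasure_eq_measure)
  then show ?thesis by eventually_elim (auto elim: eventually_mono)
qed

text \<open>The conclusion covers all large \<open>m\<close> so that \<open>AE_speed_lower\<close>
  can use one exponent together with \<open>AE_hit\<close>.\<close>

lemma AE_not_hit:
  assumes hom: "\<And>x. x > 0 \<Longrightarrow> al x = A \<and> be x = B"
    and "A \<le> a" "1 \<le> B" "a > 2" "0 < g" "g < a / (a - 2)"
  shows "\<exists>m0. \<forall>m\<ge>m0. AE \<omega> in M. \<forall>\<^sub>F i in sequentially. \<forall>j\<le>nat \<lfloor>g * real (i ^ m)\<rfloor>. X j \<omega> \<noteq> int (i ^ m)"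
proof -
  have A: "A > 0" using hom[of 1] al_pos[of 1] by simp
  \<comment> \<open>A hit by time \<open>g * N\<close> means \<open>s \<le> (g - 1) / 2 * N\<close>,
    while \<open>s\<close> is typically \<open>N / (a - 2)\<close>; \<open>\<epsilon>\<close> is the
    gap per site.\<close>
  define \<epsilon> where "\<epsilon> = (a / (a - 2) - g) / 2"
  have w: "a / (a - 2) = 1 + 2 * (1 / (a - 2))" using assms by (simp add: field_simps)
  have lin: "w - (g - 1) / 2 = (c - g) / 2" if "c = 1 + 2 * w" for c w :: real using that by (simp add: field_simps)
  have \<epsilon>: "\<epsilon> > 0" "1 / (a - 2) - (g - 1) / 2 = \<epsilon>"
    using assms(6) lin[OF w] by (simp_all only: \<epsilon>_def) simp
  obtain q C where q: "q > 1" "C \<ge> 0" and dev: "\<And>n. measure_pmf.prob (hom_chain a 1 n (0, 0))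
    {sz. \<epsilon> * (real n + 1) \<le> \<bar>real (fst sz) - (real n + 1) / (a - 2)\<bar>} \<le> C * (real n + 1) powr (1 - q)"
    using hom_chain_deviation[OF \<open>a > 2\<close>] \<epsilon>(1) by blast
  have bound: "prob (hit_by (int N) (nat \<lfloor>g * real N\<rfloor>)) \<le> C * real N powr - (q - 1)" if "N \<ge> 1" for N :: nat
  proof -
    define n where "n = N - 1"
    have N: "N = Suc n" using that by (simp add: n_def)
    define t where "t = nat \<lfloor>g * real N\<rfloor>"
    have t: "real t \<le> g * real N" using assms unfolding t_def by (intro of_nat_floor) auto
    have "prob (hit_by (int N) t) = measure_pmf.prob (chain al be (\<lambda>_. 0) (\<lambda>_. 0) (nat (int N + int t)) (int N - 1) (0, 0)) {sz. int N + 2 * int (fst sz) \<le> int t}"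
      using that by (intro prob_hit_by) auto
    \<comment> \<open>The \<open>n\<close> positive sites below \<open>N\<close>, then the sites
      \<open>0, ..., - t\<close>.\<close>
    also have "nat (int N + int t) = n + Suc t" using N by simp
    also note chain_append
    also have "chain al be (\<lambda>_. 0) (\<lambda>_. 0) n (int N - 1) (0, 0) = hom_chain A B n (0, 0)"
      by (rule chain_eq_hom_chain[OF hom]) (use N in auto)
    \<comment> \<open>Further sites can only add left steps, so they may be dropped in an upper
      bound on the hitting probability.\<close>
    also have "measure_pmf.prob (bind_pmf (hom_chain A B n (0, 0)) (chain al be (\<lambda>_. 0) (\<lambda>_. 0) (Suc t) (int N - 1 - int n)))
        {sz. int N + 2 * int (fst sz) \<le> int t} \<le> measure_pmf.prob (hom_chain A B n (0, 0)) {sz. int N + 2 * int (fst sz) \<le> int t}"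
      (is "measure_pmf.prob (bind_pmf ?h ?f) ?S \<le> _")
    proof -
      have "measure_pmf.prob (bind_pmf ?h ?f) ?S = measure_pmf.expectation ?h (\<lambda>sz. measure_pmf.prob (?f sz) ?S)"
        by (rule measure_bind_pmf)
      also have "\<dots> \<le> measure_pmf.expectation ?h (indicator ?S)"
      proof (intro integral_mono measure_pmf.integrable_const_bound[of _ 1])
        fix sz
        show "measure_pmf.prob (?f sz) ?S \<le> indicator ?S sz"
        proof (cases "sz \<in> ?S")
          case False
          have "set_pmf (?f sz) \<inter> ?S = {}"
          proof safe
            fix s z assume "(s, z) \<in> set_pmf (?f sz)" "int N + 2 * int (fst (s, z)) \<le> int t"
            then show "(s, z) \<in> {}" using False set_chain[of "(s, z)"] by fastforce
          qed
          then have "measure_pmf.prob (?f sz) ?S = 0" by (simp add: measure_pmf_zero_iff)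
          then show ?thesis by simp
        qed auto
      qed auto
      also have "\<dots> = measure_pmf.prob ?h ?S" by simp
      finally show ?thesis .
    qed
    also have "\<dots> \<le> measure_pmf.prob (hom_chain a 1 n (0, 0)) {sz. int N + 2 * int (fst sz) \<le> int t}"
    proof (cases "N \<le> t")
      case True
      have "int N + 2 * int k \<le> int t \<longleftrightarrow> k \<le> (t - N) div 2" for k using True by linarith
      then have "{sz :: nat \<times> nat. int N + 2 * int (fst sz) \<le> int t} = {sz. fst sz \<le> (t - N) div 2}" by auto
      then show ?thesis using assms A by (simp only:) (rule hom_chain_comparison, auto)
    next
      case False
      then have "{sz :: nat \<times> nat. int N + 2 * int (fst sz) \<le> int t} = {}" by auto
      then show ?thesis by simp
    qed
    also have "\<dots> \<le> measure_pmf.prob (hom_chain a 1 n (0, 0))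
        {sz. \<epsilon> * (real n + 1) \<le> \<bar>real (fst sz) - (real n + 1) / (a - 2)\<bar>}"
    proof (intro measure_pmf.finite_measure_mono subsetI, clarify)
      fix s z :: nat
      assume "int N + 2 * int (fst (s, z)) \<le> int t"
      then have "real_of_int (int N + 2 * int s) \<le> real_of_int (int t)" by (simp only: of_int_le_iff fst_conv)
      then have "real s \<le> (g - 1) / 2 * real N" using t by (simp add: field_simps)
      then have "real N / (a - 2) - real s \<ge> (1 / (a - 2) - (g - 1) / 2) * real N" by (simp add: algebra_simps)
      then have "\<epsilon> * real N \<le> real N / (a - 2) - real s" unfolding \<epsilon>(2) .
      moreover have "real n + 1 = real N" using N by simp
      ultimately show "\<epsilon> * (real n + 1) \<le> \<bar>real (fst (s, z)) - (real n + 1) / (a - 2)\<bar>" by simp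
    qed simp
    also have "\<dots> \<le> C * (real n + 1) powr (1 - q)" by (rule dev)
    finally show ?thesis using N by (simp add: t_def add.commute)
  qed
  show ?thesis
  proof (intro exI[of _ "Suc (nat \<lceil>2 / (q - 1)\<rceil>)"] allI impI)
    fix m assume m: "m \<ge> Suc (nat \<lceil>2 / (q - 1)\<rceil>)"
    then have "real m \<ge> 2 / (q - 1)" by linarith
    then have m2: "real m * (q - 1) \<ge> 2" using q by (simp add: field_simps)
    have "prob (hit_by (int (i ^ m)) (nat \<lfloor>g * real (i ^ m)\<rfloor>)) \<le> C * real (i ^ m) powr - (q - 1)" if "i \<ge> 1" for i
      by (rule bound) (use that in simp)
    then have "AE \<omega> in M. \<forall>\<^sub>F i in sequentially. \<omega> \<notin> hit_by (int (i ^ m)) (nat \<lfloor>g * real (i ^ m)\<rfloor>)"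
      by (rule borel_cantelli_powers[rotated]) (use m m2 q in auto)
    then show "AE \<omega> in M. \<forall>\<^sub>F i in sequentially. \<forall>j\<le>nat \<lfloor>g * real (i ^ m)\<rfloor>. X j \<omega> \<noteq> int (i ^ m)"
      using AE_space by eventually_elim (auto simp: hit_by_def elim: eventually_mono)
  qed
qed

lemma AE_hit:
  assumes hom: "\<And>x. x > 0 \<Longrightarrow> al x = a \<and> be x = 1"
    and left: "\<And>x. x \<le> 0 \<Longrightarrow> al x > 1 \<and> be x > 0 \<and> be x / (al x - 1) \<le> 1 / 2"
    and "a > 2" "g > a / (a - 2)"
  shows "\<exists>m0. \<forall>m\<ge>m0. AE \<omega> in M. \<forall>\<^sub>F i in sequentially. \<exists>j\<le>nat \<lfloor>g * real (i ^ m)\<rfloor>. X j \<omega> = int (i ^ m)"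
proof -
  have g: "g > 1" using assms(3,4) by (smt (verit) divide_le_eq_1_pos)
  \<comment> \<open>The gap in \<open>s\<close> per site is \<open>2 * \<epsilon>\<close>: one
    \<open>\<epsilon>\<close> for the deviation on the positive sites, one for the left steps made
    elsewhere.\<close>
  define \<epsilon> where "\<epsilon> = (g - a / (a - 2)) / 4"
  have w: "a / (a - 2) = 1 + 2 * (1 / (a - 2))" using assms by (simp add: field_simps)
  have lin: "(g - 1) / 2 = w + 2 * ((g - c) / 4)" if "c = 1 + 2 * w" for c w :: real using that by (simp add: field_simps)
  have \<epsilon>: "\<epsilon> > 0" "(g - 1) / 2 = 1 / (a - 2) + 2 * \<epsilon>"
    using assms(4) lin[OF w] by (simp_all only: \<epsilon>_def) simp
  obtain q C where q: "q > 1" "C \<ge> 0" and dev: "\<And>n. measure_pmf.prob (hom_chain a 1 n (0, 0))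
    {sz. \<epsilon> * (real n + 1) \<le> \<bar>real (fst sz) - (real n + 1) / (a - 2)\<bar>} \<le> C * (real n + 1) powr (1 - q)"
    using hom_chain_deviation[OF \<open>a > 2\<close>] \<epsilon>(1) by blast
  define W where "W = moment_bound a 1"
  have W: "W \<ge> 0" unfolding W_def using assms by (intro moment_bound_nonneg) auto
  \<comment> \<open>The deviation bound has exponent \<open>q - 1\<close>, Markov's inequality on
    the other sites exponent 1.\<close>
  define e where "e = min 1 (q - 1)"
  have e: "e > 0" using q by (simp add: e_def)
  define C' where "C' = C + W / \<epsilon>"
  have C': "C' \<ge> 0" using q W \<epsilon> by (simp add: C'_def)
  have bound: "prob (space M - hit_by (int N) (nat \<lfloor>g * real N\<rfloor>)) \<le> C' * real N powr - e" if "N \<ge> 1" for N :: nat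
  proof -
    define n where "n = N - 1"
    have N: "N = Suc n" using that by (simp add: n_def)
    define t where "t = nat \<lfloor>g * real N\<rfloor>"
    let ?h = "hom_chain a 1 n (0, 0)" and ?f = "chain al be (\<lambda>_. 0) (\<lambda>_. 0) (Suc t) 0"
    let ?S = "{sz :: nat \<times> nat. int N + 2 * int (fst sz) \<le> int t}"
    let ?D = "{sz. \<epsilon> * (real n + 1) \<le> \<bar>real (fst sz) - (real n + 1) / (a - 2)\<bar>}"
    have "prob (hit_by (int N) t) = measure_pmf.prob (chain al be (\<lambda>_. 0) (\<lambda>_. 0) (nat (int N + int t)) (int N - 1) (0, 0)) ?S"
      using that by (intro prob_hit_by) auto
    also have "nat (int N + int t) = n + Suc t" using N by simp
    also note chain_append
    also have "chain al be (\<lambda>_. 0) (\<lambda>_. 0) n (int N - 1) (0, 0) = ?h"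
      by (rule chain_eq_hom_chain[OF hom]) (use N in auto)
    also have "int N - 1 - int n = 0" using N by simp
    finally have "prob (space M - hit_by (int N) t) = measure_pmf.prob (bind_pmf ?h ?f) (- ?S)"
      by (simp add: prob_compl measure_pmf.prob_compl[of ?S, simplified] Compl_eq_Diff_UNIV del: chain.simps)
    then have "ennreal (prob (space M - hit_by (int N) t)) = (\<integral>\<^sup>+sz. ennreal (measure_pmf.prob (?f sz) (- ?S)) \<partial>?h)"
      by (simp add: emeasure_bind_pmf flip: measure_pmf.emeasure_eq_measure)
    \<comment> \<open>Given the state \<open>sz\<close> at site 1, a deviation on the positive sites
      is charged fully; otherwise the remaining sites must add \<open>\<epsilon> * N\<close> left
      steps, although their mean is at most \<open>snd sz + 1\<close>.\<close>
    also have "\<dots> \<le> (\<integral>\<^sup>+sz. indicator ?D sz + ennreal (1 / (\<epsilon> * real N)) * ennreal (real (snd sz) + 1) \<partial>?h)"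
    proof (rule nn_integral_mono)
      fix sz
      show "ennreal (measure_pmf.prob (?f sz) (- ?S)) \<le> indicator ?D sz + ennreal (1 / (\<epsilon> * real N)) * ennreal (real (snd sz) + 1)"
      proof (cases "sz \<in> ?D")
        case True
        have "ennreal (measure_pmf.prob (?f sz) (- ?S)) \<le> ennreal 1" by (intro ennreal_leI) simp
        also have "\<dots> \<le> indicator ?D sz + ennreal (1 / (\<epsilon> * real N)) * ennreal (real (snd sz) + 1)"
          using True by simp
        finally show ?thesis .
      next
        case False
        have "measure_pmf.prob (?f sz) (- ?S) \<le> measure_pmf.prob (?f sz) {sz'. \<epsilon> * real N \<le> real (fst sz') - real (fst sz)}"
        proof (intro measure_pmf.finite_measure_mono subsetI, clarify)
          fix s z
          assume "\<not> int N + 2 * int (fst (s, z)) \<le> int t"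
          then have "real_of_int (int N + 2 * int s) \<ge> real_of_int (int t) + 1" by simp
          moreover have "real t + 1 \<ge> g * real N" unfolding t_def by linarith
          ultimately have "real s \<ge> (g - 1) / 2 * real N" by (simp add: field_simps)
          then have "real s \<ge> real N / (a - 2) + 2 * (\<epsilon> * real N)" unfolding \<epsilon>(2) by (simp add: distrib_right)
          moreover have "real (fst sz) \<le> real N / (a - 2) + \<epsilon> * real N" using False N by (simp add: add.commute)
          ultimately show "\<epsilon> * real N \<le> real (fst (s, z)) - real (fst sz)" by simp
        qed simp
        also have "\<dots> \<le> (real (snd sz) + 1) / (\<epsilon> * real N)"
          using chain_left_mean[OF left, where x = 0 and c = "real (fst sz)" and sz = sz and j = "Suc t"] \<epsilon> that
          by (intro markov_pmf) (auto simp del: chain.simps ennreal_plus)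
        finally have "ennreal (measure_pmf.prob (?f sz) (- ?S)) \<le> ennreal (1 / (\<epsilon> * real N) * (real (snd sz) + 1))"
          by (intro ennreal_leI) simp
        also have "\<dots> = ennreal (1 / (\<epsilon> * real N)) * ennreal (real (snd sz) + 1)"
          using \<epsilon> by (intro ennreal_mult) auto
        also have "\<dots> \<le> indicator ?D sz + ennreal (1 / (\<epsilon> * real N)) * ennreal (real (snd sz) + 1)" by simp
        finally show ?thesis .
      qed
    qed
    also have "\<dots> = emeasure ?h ?D + ennreal (1 / (\<epsilon> * real N)) * (\<integral>\<^sup>+z. ennreal ((real z + 1) powr 1) \<partial>site_law a n)"
      by (simp add: nn_integral_add nn_integral_cmult site_law_def del: ennreal_plus)
    also have "\<dots> \<le> ennreal (C * (real n + 1) powr (1 - q)) + ennreal (1 / (\<epsilon> * real N)) * ennreal W"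
      unfolding W_def using dev[of n] assms
      by (intro add_mono mult_left_mono moment_site_law_le) (auto simp: measure_pmf.emeasure_eq_measure intro!: ennreal_leI)
    also have "\<dots> = ennreal (C * real N powr (1 - q) + 1 / (\<epsilon> * real N) * W)"
      using \<epsilon> W q N by (simp add: add.commute flip: ennreal_mult ennreal_plus)
    also have "C * real N powr (1 - q) + 1 / (\<epsilon> * real N) * W = C * real N powr (1 - q) + W / \<epsilon> * real N powr - 1"
      using that \<epsilon> by (simp add: powr_minus field_simps)
    also have "ennreal \<dots> \<le> ennreal (C' * real N powr - e)"
      unfolding C'_def distrib_right using that q W \<epsilon>
      by (intro ennreal_leI add_mono mult_left_mono powr_mono) (auto simp: e_def)
    finally show ?thesis using C' unfolding t_def by (subst (asm) ennreal_le_iff) auto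
  qed
  show ?thesis
  proof (intro exI[of _ "Suc (nat \<lceil>2 / e\<rceil>)"] allI impI)
    fix m assume m: "m \<ge> Suc (nat \<lceil>2 / e\<rceil>)"
    then have "real m \<ge> 2 / e" by linarith
    then have m2: "real m * e \<ge> 2" using e by (simp add: field_simps)
    have "prob (space M - hit_by (int (i ^ m)) (nat \<lfloor>g * real (i ^ m)\<rfloor>)) \<le> C' * real (i ^ m) powr - e" if "i \<ge> 1" for i
      by (rule bound) (use that in simp)
    then have "AE \<omega> in M. \<forall>\<^sub>F i in sequentially. \<omega> \<notin> space M - hit_by (int (i ^ m)) (nat \<lfloor>g * real (i ^ m)\<rfloor>)"
      by (rule borel_cantelli_powers[rotated]) (use m m2 q C' in auto)
    then show "AE \<omega> in M. \<forall>\<^sub>F i in sequentially. \<exists>j\<le>nat \<lfloor>g * real (i ^ m)\<rfloor>. X j \<omega> = int (i ^ m)"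
      using AE_space by eventually_elim (auto simp: hit_by_def elim: eventually_mono)
  qed
qed

section \<open>Almost sure one-sided bounds on the speed\<close>

lemma AE_speed_upper:
  assumes "\<And>x. x > 0 \<Longrightarrow> al x = A \<and> be x = B"
    and "A \<le> a" "1 \<le> B" "a > 2" "0 < g" "g < a / (a - 2)"
  shows "AE \<omega> in M. \<forall>\<delta>>0. \<forall>\<^sub>F n in sequentially. real_of_int (X n \<omega>) / real n \<le> 1 / g + \<delta>"
proof -
  obtain m0 where "\<And>m. m \<ge> m0 \<Longrightarrow> AE \<omega> in M. \<forall>\<^sub>F i in sequentially. \<forall>j\<le>nat \<lfloor>g * real (i ^ m)\<rfloor>. X j \<omega> \<noteq> int (i ^ m)"
    using AE_not_hit[OF assms] by blast
  from this[OF le_SucI[OF order_refl]] show ?thesis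
    using AE_unit_steps
  proof eventually_elim
    case (elim \<omega>)
    then show ?case
      using speed_upper[of "\<lambda>n. X n \<omega>" g "Suc m0"] assms(5) by simp
  qed
qed

lemma AE_speed_lower:
  assumes "\<And>x. x > 0 \<Longrightarrow> al x = a \<and> be x = 1"
    and "\<And>x. x \<le> 0 \<Longrightarrow> al x > 1 \<and> be x > 0 \<and> be x / (al x - 1) \<le> 1 / 2"
    and "a > 2" "g > a / (a - 2)" "0 < g'" "g' < a / (a - 2)"
  shows "AE \<omega> in M. \<forall>\<delta>>0. \<forall>\<^sub>F n in sequentially. real_of_int (X n \<omega>) / real n \<ge> (1 + g') / g - 1 - \<delta>"
proof -
  have g: "g > 0" using assms(4-6) by linarith
  obtain m0 where m0: "\<And>m. m \<ge> m0 \<Longrightarrow> AE \<omega> in M. \<forall>\<^sub>F i in sequentially. \<forall>j\<le>nat \<lfloor>g' * real (i ^ m)\<rfloor>. X j \<omega> \<noteq> int (i ^ m)"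
    using AE_not_hit[OF assms(1) order_refl order_refl assms(3,5,6)] by blast
  obtain m1 where m1: "\<And>m. m \<ge> m1 \<Longrightarrow> AE \<omega> in M. \<forall>\<^sub>F i in sequentially. \<exists>j\<le>nat \<lfloor>g * real (i ^ m)\<rfloor>. X j \<omega> = int (i ^ m)"
    using AE_hit[OF assms(1-4)] by blast
  define m where "m = Suc (max m0 m1)"
  have m: "m0 \<le> m" "m1 \<le> m" "m \<ge> 1" by (auto simp: m_def)
  show ?thesis using m0[OF m(1)] m1[OF m(2)] AE_unit_steps
  proof eventually_elim
    case (elim \<omega>)
    then show ?case
      using speed_lower[of "\<lambda>n. X n \<omega>" g' g m] assms(5) g m(3) by simp
  qed
qed

end


section \<open>The edge-reinforced walk\<close>

lemma rights_minus: "rights (\<lambda>n. - x n) n z = lefts x n (- z)"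
  and lefts_minus: "lefts (\<lambda>n. - x n) n z = rights x n (- z)"
  unfolding rights_def lefts_def by (intro sum.cong refl arg_cong[of _ _ of_bool]; auto)+

text \<open>In the slow case the lower bound on the walk is the upper bound for its
  reflection.\<close>

lemma (in urn_walk) reflected: "urn_walk M (\<lambda>n \<omega>. - X n \<omega>) (\<lambda>z. be (- z)) (\<lambda>z. al (- z))"
proof unfold_locales
  show "random_variable (count_space UNIV) (\<lambda>\<omega>. - X n \<omega>)" for n
    using rv[of n] by (rule measurable_compose) simp
  show "AE \<omega> in M. - X 0 \<omega> = 0" using start by simp
  show "AE \<omega> in M. \<forall>n. - X (Suc n) \<omega> = - X n \<omega> + 1 \<or> - X (Suc n) \<omega> = - X n \<omega> - 1"
    using nearest_neighbour
  proof eventually_elim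
    case (elim \<omega>)
    show ?case
    proof
      show "- X (Suc n) \<omega> = - X n \<omega> + 1 \<or> - X (Suc n) \<omega> = - X n \<omega> - 1" for n
        using elim[rule_format, of n] by auto
    qed
  qed
  show "be (- z) > 0" "al (- z) > 0" for z using al_pos be_pos by auto
  fix x :: "nat \<Rightarrow> int" and n
  assume nn: "nn_path x n" and pos: "\<P>(\<omega> in M. \<forall>i\<le>n. - X i \<omega> = x i) > 0"
  define y where "y i = - x i" for i
  have x: "x = (\<lambda>i. - y i)" by (simp add: y_def)
  have nny: "nn_path y n"
    unfolding nn_path_def
  proof (intro conjI allI impI)
    show "y 0 = 0" using nn by (simp add: y_def nn_path_def)
    show "y (Suc i) = y i + 1 \<or> y (Suc i) = y i - 1" if "i < n" for i
      using nn that unfolding nn_path_def y_def by (metis add_uminus_conv_diff minus_add_distrib minus_diff_eq minus_minus uminus_add_conv_diff)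
  qed
  let ?A = "al (y n) + real (rights y n (y n))" and ?B = "be (y n) + real (lefts y n (y n))"
  have AB: "?A > 0" "?B > 0" using al_pos be_pos by (auto intro: add_pos_nonneg)
  have pos': "prob (hist n y) > 0" using pos by (simp add: hist_def x)
  have "\<P>(\<omega> in M. - X (Suc n) \<omega> = x n + 1 \<bar> \<forall>i\<le>n. - X i \<omega> = x i) =
      prob (hist (Suc n) (y(Suc n := y n - 1))) / prob (hist n y)"
    unfolding cond_prob_def hist_def x
    by (intro arg_cong2[of _ _ _ _ "(/)"] arg_cong[of _ _ prob]) (auto simp: le_Suc_eq)
  also have "\<dots> = 1 - ?A / (?A + ?B)"
    using prob_hist_step(2)[OF nny sets.top] pos' by simp
  also have "\<dots> = ?B / (?B + ?A)" using AB by (simp add: field_simps)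
  finally show "\<P>(\<omega> in M. - X (Suc n) \<omega> = x n + 1 \<bar> \<forall>i\<le>n. - X i \<omega> = x i) =
    (be (- x n) + real (rights x n (x n))) / ((be (- x n) + real (rights x n (x n))) + (al (- x n) + real (lefts x n (x n))))"
    unfolding x rights_minus lefts_minus by simp
qed

text \<open>By the flow identity both edge weights at the present site are twice a constant plus
  twice the number of departures across the edge, and the factor 2 cancels. The shifts at
  \<open>z < 0\<close> and \<open>0 < z\<close> account for the crossing by which the walk first
  arrived from the side of 0.\<close>

lemma (in biased_errw) errw_urn_walk:
  assumes "lam \<ge> 0"
  shows "urn_walk M X (\<lambda>z. (lam + 1 + of_bool (z < 0)) / 2) (\<lambda>z. (1 + of_bool (0 < z)) / 2)"
proof unfold_locales
  fix x :: "nat \<Rightarrow> int" and n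
  assume nn: "nn_path x n" and pos: "\<P>(\<omega> in M. \<forall>i\<le>n. X i \<omega> = x i) > 0"
  have w: "edge_weight x n z = 1 + real (rights x n z) + real (lefts x n (z + 1))" for z
    by (simp add: edge_weight_def rights_def lefts_def sum.distrib)
  have 1: "lam + edge_weight x n (x n) = 2 * ((lam + 1 + of_bool (x n < 0)) / 2 + real (rights x n (x n)))"
  proof -
    have "real (rights x n (x n)) + of_bool (x n < 0) = real (lefts x n (x n + 1))"
      unfolding rights_flow_nat[OF nn, symmetric] by simp
    then show ?thesis unfolding w by (simp add: field_simps)
  qed
  have "int (rights x n (x n - 1)) = int (lefts x n (x n)) + of_bool (0 < x n)"
    using rights_lefts_flow[OF nn, of "x n - 1"] by (auto split: if_splits)
  then have "real (rights x n (x n - 1)) = real (lefts x n (x n)) + of_bool (0 < x n)"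
    by (auto split: if_splits)
  then have 2: "edge_weight x n (x n - 1) = 2 * ((1 + of_bool (0 < x n)) / 2 + real (lefts x n (x n)))"
    unfolding w by simp
  show "\<P>(\<omega> in M. X (Suc n) \<omega> = x n + 1 \<bar> \<forall>i\<le>n. X i \<omega> = x i) =
    ((lam + 1 + of_bool (x n < 0)) / 2 + real (rights x n (x n))) /
    ((lam + 1 + of_bool (x n < 0)) / 2 + real (rights x n (x n)) + ((1 + of_bool (0 < x n)) / 2 + real (lefts x n (x n))))"
    unfolding step_right[OF pos] 1 2 distrib_left[symmetric] by (rule mult_divide_mult_cancel_left) simp
qed (use random_variable_X start nearest_neighbour assms in \<open>auto intro: add_nonneg_pos add_pos_nonneg\<close>)

theorem theorem6p8:
  fixes M :: "'a measure" and X :: "nat \<Rightarrow> 'a \<Rightarrow> int" and lam :: real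
  assumes "lam \<ge> 0"
    and "biased_errw M X lam"
  shows "((\<exists>v>0. has_speed M X v) \<longleftrightarrow> lam > 3) \<and>
         (lam > 3 \<longrightarrow> has_speed M X ((lam - 3) / (lam + 1))) \<and>
         (\<not> lam > 3 \<longrightarrow> has_speed M X 0)"
proof -
  define al be :: "int \<Rightarrow> real"
    where "al z = (lam + 1 + of_bool (z < 0)) / 2" and "be z = (1 + of_bool (0 < z)) / 2" for z
  interpret E: biased_errw M X lam by fact
  interpret urn_walk M X al be
    unfolding al_def be_def by (rule E.errw_urn_walk) fact
  interpret R: urn_walk M "\<lambda>n \<omega>. - X n \<omega>" "\<lambda>z. be (- z)" "\<lambda>z. al (- z)"
    by (rule reflected)
  have fast: "has_speed M X ((lam - 3) / (lam + 1))" if lam: "lam > 3"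
  proof -
    define a where "a = (lam + 1) / 2"
    define c where "c = a / (a - 2)"
    have a: "a > 2" using lam by (simp add: a_def)
    have c: "c > 0" "1 / c = (lam - 3) / (lam + 1)" using lam by (simp_all add: c_def a_def field_simps)
    \<comment> \<open>The limit \<open>c\<close> of hitting time over level is approached from both
      sides along countable sequences, so that the exceptional null sets can be united; the
      \<open>k + 2\<close> keeps \<open>g' 0\<close> positive.\<close>
    define g' g where "g' k = c - c / real (k + 2)" and "g k = c + 1 / real (k + 1)" for k
    have g': "0 < g' k" "g' k < c" and g: "g k > c" for k
      using c(1) by (simp_all add: g'_def g_def field_simps add_pos_nonneg)
    have lims: "g' \<longlonglongrightarrow> c" "g \<longlonglongrightarrow> c"
      unfolding g'_def g_def by real_asymp+
    have "AE \<omega> in M. \<forall>k. \<forall>\<delta>>0. \<forall>\<^sub>F n in sequentially. real_of_int (X n \<omega>) / real n \<le> 1 / g' k + \<delta>"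
      unfolding AE_all_countable
    proof
      fix k
      show "AE \<omega> in M. \<forall>\<delta>>0. \<forall>\<^sub>F n in sequentially. real_of_int (X n \<omega>) / real n \<le> 1 / g' k + \<delta>"
        by (rule AE_speed_upper[of a 1 a]) (use a g' in \<open>auto simp: al_def be_def a_def c_def\<close>)
    qed
    moreover have "AE \<omega> in M. \<forall>k. \<forall>\<delta>>0. \<forall>\<^sub>F n in sequentially.
        real_of_int (X n \<omega>) / real n \<ge> (1 + g' k) / g k - 1 - \<delta>"
      unfolding AE_all_countable
    proof
      fix k
      \<comment> \<open>The quotient \<open>be / (al - 1)\<close> is \<open>1 / (lam - 1)\<close> at
        site 0 and \<open>1 / lam\<close> at the negative sites, below 1/2 because
        \<open>lam > 3\<close>.\<close>
      show "AE \<omega> in M. \<forall>\<delta>>0. \<forall>\<^sub>F n in sequentially. real_of_int (X n \<omega>) / real n \<ge> (1 + g' k) / g k - 1 - \<delta>"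
        by (rule AE_speed_lower[of a])
          (use a g g' lam in \<open>auto simp: al_def be_def a_def c_def field_simps\<close>)
    qed
    ultimately show ?thesis unfolding has_speed_def
    proof eventually_elim
      case (elim \<omega>)
      show ?case
      proof (rule tendsto_squeeze_eventually)
        show "(\<lambda>k. 1 / g' k) \<longlonglongrightarrow> (lam - 3) / (lam + 1)"
          unfolding c(2)[symmetric] using c(1) by (intro tendsto_intros lims) auto
        have "(\<lambda>k. (1 + g' k) / g k - 1) \<longlonglongrightarrow> (1 + c) / c - 1"
          using c(1) by (intro tendsto_intros lims) auto
        also have "(1 + c) / c - 1 = 1 / c" using c(1) by (simp add: field_simps)
        finally show "(\<lambda>k. (1 + g' k) / g k - 1) \<longlonglongrightarrow> (lam - 3) / (lam + 1)" unfolding c(2) .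
      qed (use elim in auto)
    qed
  qed
  have slow: "has_speed M X 0" if lam: "\<not> lam > 3"
  proof -
    \<comment> \<open>For \<open>a = 2 + 1 / (k + 1)\<close> the quotient \<open>a / (a - 2)\<close>
      is \<open>2 * (k + 1) + 1\<close>, so the dominating chains allow speed bounds tending to
      0.\<close>
    have a: "2 + 1 / real (k + 1) > 2" "real (k + 1) < (2 + 1 / real (k + 1)) / (2 + 1 / real (k + 1) - 2)" for k
    proof -
      have "(2 + 1 / N) / (2 + 1 / N - 2) = 2 * N + 1" if "N > 0" for N :: real
        using that by (simp add: field_simps)
      from this[of "real (k + 1)"] show "real (k + 1) < (2 + 1 / real (k + 1)) / (2 + 1 / real (k + 1) - 2)"
        by simp
    qed simp
    have "AE \<omega> in M. \<forall>k. \<forall>\<delta>>0. \<forall>\<^sub>F n in sequentially. real_of_int (X n \<omega>) / real n \<le> 1 / real (k + 1) + \<delta>"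
      unfolding AE_all_countable
    proof
      fix k
      have "(lam + 1) / 2 \<le> 2" using lam by simp
      then have "(lam + 1) / 2 \<le> 2 + 1 / real (k + 1)" by (rule order_trans[OF _ less_imp_le[OF a(1)]])
      then show "AE \<omega> in M. \<forall>\<delta>>0. \<forall>\<^sub>F n in sequentially. real_of_int (X n \<omega>) / real n \<le> 1 / real (k + 1) + \<delta>"
        by (intro AE_speed_upper[where A = "(lam + 1) / 2" and B = 1, OF _ _ _ a(1) _ a(2)])
          (auto simp: al_def be_def)
    qed
    moreover have "AE \<omega> in M. \<forall>k. \<forall>\<delta>>0. \<forall>\<^sub>F n in sequentially. real_of_int (- X n \<omega>) / real n \<le> 1 / real (k + 1) + \<delta>"
      unfolding AE_all_countable
    proof
      fix k
      \<comment> \<open>At its positive sites the reflected walk has right weight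
        \<open>1 / 2\<close> and left weight \<open>(lam + 2) / 2\<close>, which is at least
        1.\<close>
      have "(1 :: real) / 2 \<le> 2 + 1 / real (k + 1)" using a(1)[of k] by linarith
      then show "AE \<omega> in M. \<forall>\<delta>>0. \<forall>\<^sub>F n in sequentially. real_of_int (- X n \<omega>) / real n \<le> 1 / real (k + 1) + \<delta>"
        using assms(1) by (intro R.AE_speed_upper[where A = "1 / 2" and B = "(lam + 2) / 2", OF _ _ _ a(1) _ a(2)]) (auto simp: al_def be_def)
    qed
    ultimately show ?thesis unfolding has_speed_def
    proof eventually_elim
      case (elim \<omega>)
      show ?case
      proof (rule tendsto_squeeze_eventually)
        show "(\<lambda>k. 1 / real (k + 1)) \<longlonglongrightarrow> 0" "(\<lambda>k. - (1 / real (k + 1))) \<longlonglongrightarrow> 0" by real_asymp+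
        fix k and \<delta> :: real assume "\<delta> > 0"
        then show "\<forall>\<^sub>F n in sequentially. real_of_int (X n \<omega>) / real n \<le> 1 / real (k + 1) + \<delta>" using elim(1) by blast
        have "\<forall>\<^sub>F n in sequentially. real_of_int (- X n \<omega>) / real n \<le> 1 / real (k + 1) + \<delta>"
          using elim(2) \<open>\<delta> > 0\<close> by blast
        then show "\<forall>\<^sub>F n in sequentially. real_of_int (X n \<omega>) / real n \<ge> - (1 / real (k + 1)) - \<delta>"
          by eventually_elim simp
      qed
    qed
  qed
  have "lam > 3" if v: "v > 0" "has_speed M X v" for v
  proof (rule ccontr)
    assume "\<not> lam > 3"
    then have "has_speed M X 0" by (rule slow)
    with v(2) have "AE \<omega> in M. False" unfolding has_speed_def
      by eventually_elim (use v(1) LIMSEQ_unique in fastforce)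
    then show False by simp
  qed
  moreover have "\<exists>v>0. has_speed M X v" if "lam > 3"
    using fast[OF that] that by (intro exI[of _ "(lam - 3) / (lam + 1)"]) auto
  ultimately show ?thesis using fast slow by blast
qed

end
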